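(* Let $K$ be a finite simplicial complex, $k$ a field of characteristic $0$, $A^2$ a finite-dimensional normed $k$-vector space with norm $\|\cdot\|$, and $(\phi_a)_{a\in A^2}$ a family of filtration functions $\phi_a:\mathrm{Simp}(K)\to\mathbb{R}$ for which there is a constant $L\ge 0$ with $$\sup_{\sigma\in\mathrm{Simp}(K)}|\phi_a(\sigma)-\phi_{a'}(\sigma)|\le L\,\|a-a'\|\qquad\text{for all }a,a'\in A^2.$$ Let $c,c'\in A^2$ and let $I=[b,d)$ be a bar in the barcode of $H_\ast(C_\bullet,F^{\,c}_\bullet)$. If $L\,\|c-c'\|<\tfrac12(d-b)$, then there exists a matching bar $I'=[b',d')$ (in the same homological degree) in the barcode of $H_\ast(C_\bullet,F^{\,c'}_\bullet)$ with $$|b-b'|\le L\,\|c-c'\|\quad\text{and}\quad |d-d'|\le L\,\|c-c'\|.$$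
   Context: $A^2$ is the degree-$2$ component of a $\mathbb{Z}$-graded associative unital algebra $A^\bullet$ over $k$ (underlying a curved dg-algebra) with finite-dimensional graded components; the norm on $A^2$ is taken with respect to a fixed absolute value on $k$. $\mathrm{Simp}(K)$ is the set of simplices of $K$. A filtration function is a function $\phi:\mathrm{Simp}(K)\to\mathbb{R}$ that is monotone under the face relation ($\phi(\tau)\le\phi(\sigma)$ whenever $\tau$ is a face of $\sigma$), so that sublevel sets are subcomplexes. $(C_\bullet,\partial)=(C_\bullet(K;k),\partial)$ is the simplicial chain complex of $K$ with coefficients in $k$. For $a\in A^2$, a simplex $\sigma$ enters at time $t=\phi_a(\sigma)$: $F^{\,a}_t$ is the chain subcomplex spanned by the simplices $\sigma$ with $\phi_a(\sigma)\le t$, and $(C_\bullet,F^{\,a}_\bullet)$ is the resulting filtered chain complex. $H_\ast(C_\bullet,F^{\,a}_\bullet)$ is the $\mathbb{R}$-indexed persistence module $t\mapsto H_\ast(F^{\,a}_t)$ obtained by applying homology in each homological degree, with maps induced by inclusions. Its barcode in each homological degree is the multiset of half-open intervals $[b,d)$ in its interval decomposition; here $d$ denotes the death time (not a differential), possibly $+\infty$, in which case the conclusion $|d-d'|\le L\|c-c'\|$ is read as $d'=+\infty$. *)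

theory Defs
  imports
    "HOL-Algebra.Module"
    "HOL-Library.Poly_Mapping"
    "HOL-Library.Set_Algebras"
    "HOL-Library.Extended_Real"
    "HOL-Library.Multiset"
    "HOL-Library.FuncSet"
begin

section \<open>Finite-dimensional normed vector spaces over a field with absolute value\<close>

locale absolute_value =
  fixes absv :: "'k::field \<Rightarrow> real"
  assumes absv_nonneg: "absv x \<ge> 0"
    and absv_eq_0_iff: "absv x = 0 \<longleftrightarrow> x = 0"
    and absv_mult: "absv (x * y) = absv x * absv y"
    and absv_triangle: "absv (x + y) \<le> absv x + absv y"

locale fin_dim_normed_space =
  absolute_value absv + finite_dimensional_vector_space scale Basis
  for absv :: "'k::field \<Rightarrow> real"
    and scale :: "'k \<Rightarrow> 'a::ab_group_add \<Rightarrow> 'a"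
    and Basis :: "'a set" +
  fixes nrm :: "'a \<Rightarrow> real"
  assumes nrm_nonneg: "nrm x \<ge> 0"
    and nrm_eq_0_iff: "nrm x = 0 \<longleftrightarrow> x = 0"
    and nrm_scale: "nrm (scale r x) = absv r * nrm x"
    and nrm_triangle: "nrm (x + y) \<le> nrm x + nrm y"


section \<open>Simplicial complexes and their chains\<close>

text \<open>A complex is identified with the set of its (nonempty) simplices.\<close>

definition finite_simplicial_complex :: "'v set set \<Rightarrow> bool" where
  "finite_simplicial_complex K \<longleftrightarrow>
     finite K \<and> (\<forall>\<sigma>\<in>K. finite \<sigma> \<and> \<sigma> \<noteq> {}) \<and>
     (\<forall>\<sigma>\<in>K. \<forall>\<tau>. \<tau> \<subseteq> \<sigma> \<and> \<tau> \<noteq> {} \<longrightarrow> \<tau> \<in> K)"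

definition filtration_function :: "'v set set \<Rightarrow> ('v set \<Rightarrow> real) \<Rightarrow> bool" where
  "filtration_function K \<phi> \<longleftrightarrow> (\<forall>\<sigma>\<in>K. \<forall>\<tau>\<in>K. \<tau> \<subseteq> \<sigma> \<longrightarrow> \<phi> \<tau> \<le> \<phi> \<sigma>)"

definition sublevel :: "'v set set \<Rightarrow> ('v set \<Rightarrow> real) \<Rightarrow> real \<Rightarrow> 'v set set" where
  "sublevel K \<phi> t = {\<sigma>\<in>K. \<phi> \<sigma> \<le> t}"

text \<open>
  Chains are finitely supported functions on simplices. The order on the vertices
  orients each simplex: \<open>\<sigma>\<close> with vertices \<open>v\<^sub>0 < \<dots> < v\<^sub>n\<close> stands for \<open>[v\<^sub>0, \<dots>, v\<^sub>n]\<close>,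
  and \<open>card {u\<in>\<sigma>. u < v}\<close> is the position of \<open>v\<close> in this list.
  The condition \<open>\<sigma> - {v} \<noteq> {}\<close> makes the complex unreduced: vertices have boundary \<open>0\<close>.
\<close>

definition chain_scale :: "'k::field \<Rightarrow> ('v set \<Rightarrow>\<^sub>0 'k) \<Rightarrow> ('v set \<Rightarrow>\<^sub>0 'k)" where
  "chain_scale r x = Poly_Mapping.map ((*) r) x"

definition chains :: "nat \<Rightarrow> 'v set set \<Rightarrow> ('v set \<Rightarrow>\<^sub>0 'k::field) set" where
  "chains n S = {x. Poly_Mapping.keys x \<subseteq> {\<sigma>\<in>S. card \<sigma> = n + 1}}"

definition boundary :: "('v::linorder set \<Rightarrow>\<^sub>0 'k::field) \<Rightarrow> ('v set \<Rightarrow>\<^sub>0 'k)" where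
  "boundary x =
     (\<Sum>\<sigma>\<in>Poly_Mapping.keys x. \<Sum>v\<in>{v\<in>\<sigma>. \<sigma> - {v} \<noteq> {}}.
        Poly_Mapping.single (\<sigma> - {v})
          ((-1) ^ card {u\<in>\<sigma>. u < v} * Poly_Mapping.lookup x \<sigma>))"

definition cycles :: "nat \<Rightarrow> 'v::linorder set set \<Rightarrow> ('v set \<Rightarrow>\<^sub>0 'k::field) set" where
  "cycles n S = {x \<in> chains n S. boundary x = 0}"

definition boundaries :: "nat \<Rightarrow> 'v::linorder set set \<Rightarrow> ('v set \<Rightarrow>\<^sub>0 'k::field) set" where
  "boundaries n S = boundary ` chains (n + 1) S"

text \<open>
  The quotient of cycles by boundaries, with cosets as elements; sums of sets are elementwise,
  and adding \<open>boundaries n S\<close> to a scaled coset matters only for the scalar \<open>0\<close>.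
  The fields \<open>mult\<close> and \<open>one\<close> of the record type are meaningless for modules.
\<close>

definition homology ::
  "nat \<Rightarrow> 'v::linorder set set \<Rightarrow> ('k::field, ('v set \<Rightarrow>\<^sub>0 'k) set) module" where
  "homology n S =
     \<lparr>carrier = {z +o boundaries n S | z. z \<in> cycles n S},
      monoid.mult = undefined, one = undefined,
      zero = boundaries n S,
      add = (\<lambda>A B. A + B),
      smult = (\<lambda>r A. chain_scale r ` A + boundaries n S)\<rparr>"


section \<open>Persistence modules and barcodes\<close>

text \<open>\<open>trans V s t\<close> is meant for \<open>s \<le> t\<close> and for arguments in the carrier of \<open>space V s\<close> only.\<close>

record ('k, 'm) persistence_module =
  space :: "real \<Rightarrow> ('k, 'm) module"
  trans :: "real \<Rightarrow> real \<Rightarrow> 'm \<Rightarrow> 'm"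

definition persistence_iso ::
  "('k, 'm) persistence_module \<Rightarrow> ('k, 'n) persistence_module \<Rightarrow> bool" where
  "persistence_iso V W \<longleftrightarrow>
     (\<exists>f. (\<forall>t. bij_betw (f t) (carrier (space V t)) (carrier (space W t)) \<and>
               (\<forall>x\<in>carrier (space V t). \<forall>y\<in>carrier (space V t).
                  f t (x \<oplus>\<^bsub>space V t\<^esub> y) = f t x \<oplus>\<^bsub>space W t\<^esub> f t y) \<and>
               (\<forall>r. \<forall>x\<in>carrier (space V t).
                  f t (r \<odot>\<^bsub>space V t\<^esub> x) = r \<odot>\<^bsub>space W t\<^esub> f t x)) \<and>
          (\<forall>s t. s \<le> t \<longrightarrow>
             (\<forall>x\<in>carrier (space V s). f t (trans V s t x) = trans W s t (f s x))))"

definition interval_module :: "real set \<Rightarrow> ('k::field, 'k) persistence_module" where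
  "interval_module I =
     \<lparr>space = (\<lambda>t. \<lparr>carrier = (if t \<in> I then UNIV else {0}),
                    monoid.mult = undefined, one = undefined,
                    zero = 0, add = (+), smult = (*)\<rparr>),
      trans = (\<lambda>s t x. if s \<in> I \<and> t \<in> I then x else 0)\<rparr>"

text \<open>Direct sum of a family with a finite index set \<open>J\<close>.\<close>

definition finite_direct_sum ::
  "'i set \<Rightarrow> ('i \<Rightarrow> ('k, 'm) persistence_module) \<Rightarrow> ('k, 'i \<Rightarrow> 'm) persistence_module" where
  "finite_direct_sum J V =
     \<lparr>space = (\<lambda>t. \<lparr>carrier = (\<Pi>\<^sub>E j\<in>J. carrier (space (V j) t)),
                    monoid.mult = undefined, one = undefined,
                    zero = (\<lambda>j\<in>J. \<zero>\<^bsub>space (V j) t\<^esub>),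
                    add = (\<lambda>x y. \<lambda>j\<in>J. x j \<oplus>\<^bsub>space (V j) t\<^esub> y j),
                    smult = (\<lambda>r x. \<lambda>j\<in>J. r \<odot>\<^bsub>space (V j) t\<^esub> x j)\<rparr>),
      trans = (\<lambda>s t x. \<lambda>j\<in>J. trans (V j) s t (x j))\<rparr>"

text \<open>A bar \<open>(b, d)\<close> represents the half-open interval from \<open>b\<close> to \<open>d\<close>, where \<open>d\<close> may be \<open>\<infinity>\<close>.\<close>

type_synonym bar = "real \<times> ereal"

definition bar_interval :: "bar \<Rightarrow> real set" where
  "bar_interval I = {t. fst I \<le> t \<and> ereal t < snd I}"

text \<open>
  The index \<open>(I, i)\<close> is the \<open>i\<close>-th copy of the bar \<open>I\<close>. Multisets are finite, which
  suffices for the homology of sublevel filtrations of finite complexes.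
\<close>

definition interval_decomposition ::
  "('k::field, 'm) persistence_module \<Rightarrow> bar multiset \<Rightarrow> bool" where
  "interval_decomposition V B \<longleftrightarrow>
     (\<forall>I\<in>#B. ereal (fst I) < snd I) \<and>
     persistence_iso V
       (finite_direct_sum {(I, i). i < count B I} (\<lambda>(I, i). interval_module (bar_interval I)))"

definition barcode :: "('k::field, 'm) persistence_module \<Rightarrow> bar multiset" where
  "barcode V = (THE B. interval_decomposition V B)"

text \<open>
  Inclusion of sublevel complexes sends the class \<open>z + boundaries n (sublevel K \<phi> s)\<close>
  to \<open>z + boundaries n (sublevel K \<phi> t)\<close>.
\<close>

definition persistent_homology ::
  "nat \<Rightarrow> 'v::linorder set set \<Rightarrow> ('v set \<Rightarrow> real) \<Rightarrow>
     ('k::field, ('v set \<Rightarrow>\<^sub>0 'k) set) persistence_module" where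
  "persistent_homology n K \<phi> =
     \<lparr>space = (\<lambda>t. homology n (sublevel K \<phi> t)),
      trans = (\<lambda>s t A. A + boundaries n (sublevel K \<phi> t))\<rparr>"

end

theory Submission
  imports Defs "HOL-Library.Product_Lexorder"
begin

text \<open>
  A filtered complex over a field has a basis, adapted to the filtration, in which the boundary
  operator maps each basis element to \<open>0\<close> or to another basis element, no element being hit twice.
  A cycle of this basis is born when its simplex enters and dies when the simplex bounding it
  enters; this yields an interval decomposition.

  For stability, let \<open>x\<close> generate the copies of the bar \<open>[b, d)\<close> at time \<open>b\<close>, and push its image under
  the \<open>\<epsilon>\<close>-shift to a time \<open>T\<close> just below \<open>d - \<epsilon>\<close> in the other module. The resulting element
  comes from time \<open>b + \<epsilon>\<close>, is killed by time \<open>d + \<epsilon>\<close>, and cannot come from any time below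
  \<open>b - \<epsilon>\<close>: shifting back would exhibit \<open>x\<close>, at a time before \<open>d\<close>, as coming from before \<open>b\<close>.
  So it has a nonzero coordinate on a bar within \<open>\<epsilon>\<close> of \<open>[b, d)\<close>. Applied to all
  combinations of the copies of \<open>[b, d)\<close>, the argument bounds multiplicities; its case
  \<open>\<epsilon> = 0\<close> is the uniqueness of barcodes.
\<close>

section \<open>Linear algebra of indexed bases and cosets\<close>

context vector_space
begin

text \<open>Scalars are indexed by \<open>S\<close> rather than by vectors, so that they stay
  attached to simplices when basis vectors are replaced in the normal form.\<close>

lemma span_image_finite_iff:
  assumes "finite S"
  shows "x \<in> span (e ` S) \<longleftrightarrow> (\<exists>a. x = (\<Sum>i\<in>S. a i *s e i))"
proof
  show "x \<in> span (e ` S)" if "\<exists>a. x = (\<Sum>i\<in>S. a i *s e i)"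
    using that by (fastforce intro: span_sum span_scale span_base)
  show "x \<in> span (e ` S) \<Longrightarrow> \<exists>a. x = (\<Sum>i\<in>S. a i *s e i)"
    using assms
  proof (induction S arbitrary: x rule: finite_induct)
    case (insert i S)
    then obtain k where "x - k *s e i \<in> span (e ` S)"
      by (auto simp: span_breakdown_eq)
    then obtain a where a: "x - k *s e i = (\<Sum>j\<in>S. a j *s e j)"
      using insert.IH by blast
    have "(\<Sum>j\<in>S. (a(i := k)) j *s e j) = (\<Sum>j\<in>S. a j *s e j)"
      using insert.hyps by (intro sum.cong) auto
    then have "x = (\<Sum>j\<in>insert i S. (a(i := k)) j *s e j)"
      using a insert.hyps by (simp add: algebra_simps)
    then show ?case by blast
  qed auto
qed

lemma independent_familyD:
  assumes "finite S" "inj_on e S" "independent (e ` S)"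
    and "(\<Sum>i\<in>S. a i *s e i) = 0" "i \<in> S"
  shows "a i = 0"
proof -
  have "(\<Sum>v\<in>e ` S. a (inv_into S e v) *s v) = (\<Sum>i\<in>S. a i *s e i)"
    using assms(2) by (simp add: sum.reindex)
  then have "a (inv_into S e (e i)) = 0"
    using assms by (intro independentD[of "e ` S" "e ` S" "\<lambda>v. a (inv_into S e v)"]) auto
  then show ?thesis using assms by simp
qed

lemma independent_family_if_same_span:
  assumes "finite S" "inj_on u S" "independent (u ` S)" "span (e ` S) = span (u ` S)"
  shows "inj_on e S" "independent (e ` S)"
proof -
  obtain B where B: "B \<subseteq> e ` S" "independent B" "e ` S \<subseteq> span B"
    using maximal_independent_subset by blast
  have fin: "finite B" using B(1) assms(1) finite_subset by blast
  have "u ` S \<subseteq> span B"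
    by (metis B(3) assms(4) dual_order.trans span_minimal span_superset subspace_span)
  then have "card (u ` S) \<le> card B"
    using independent_span_bound[OF fin assms(3)] by blast
  moreover have "card B \<le> card (e ` S)" "card (e ` S) \<le> card S" "card (u ` S) = card S"
    using B(1) assms by (auto intro: card_mono card_image_le simp: card_image)
  ultimately have *: "card B = card (e ` S)" "card (e ` S) = card S" by linarith+
  then show "inj_on e S" using assms(1) by (simp add: eq_card_imp_inj_on)
  have "B = e ` S" using * B(1) assms(1) by (simp add: card_subset_eq)
  then show "independent (e ` S)" using B by simp
qed

text \<open>The exchange step of the normal form: a boundary \<open>w\<close> takes the place of the
  basis cycle \<open>x\<close> that occurs in it with coefficient \<open>c\<close>.\<close>

lemma span_insert_replace:
  assumes "c \<noteq> 0" "w - c *s x \<in> span X"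
  shows "span (insert w X) = span (insert x X)"
proof -
  have "span (insert w X) = span (insert (c *s x) X)"
    using assms(2) by (rule eq_span_insert_eq)
  also have "\<dots> = span (insert x X)"
  proof -
    have "c *s x \<in> span (insert x X)" by (simp add: span_base span_scale)
    moreover have "inverse c *s (c *s x) \<in> span (insert (c *s x) X)"
      by (intro span_scale span_base) simp
    then have "x \<in> span (insert (c *s x) X)" using assms(1) by simp
    moreover have "X \<subseteq> span (insert x X)" "X \<subseteq> span (insert (c *s x) X)"
      by (auto intro: span_base)
    ultimately show ?thesis by (simp add: span_eq)
  qed
  finally show ?thesis .
qed

text \<open>The last property matters most: cycles and boundaries will be spans of subfamilies of
  one basis, so that membership in them becomes vanishing of coordinates.\<close>

lemma family_coordinates_exist:
  assumes "finite E" "inj_on e E" "independent (e ` E)"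
  obtains co where
    "\<And>x y i. x \<in> span (e ` E) \<Longrightarrow> y \<in> span (e ` E) \<Longrightarrow> co (x + y) i = co x i + co y i"
    "\<And>r x i. x \<in> span (e ` E) \<Longrightarrow> co (r *s x) i = r * co x i"
    "\<And>a i. i \<in> E \<Longrightarrow> co (\<Sum>k\<in>E. a k *s e k) i = a i"
    "\<And>x S. x \<in> span (e ` E) \<Longrightarrow> S \<subseteq> E \<Longrightarrow> x \<in> span (e ` S) \<longleftrightarrow> (\<forall>i\<in>E - S. co x i = 0)"
proof -
  define co where "co x i = representation (e ` E) x (e i)" for x i
  have sum_co: "(\<Sum>i\<in>E. co x i *s e i) = x" if "x \<in> span (e ` E)" for x
    using sum_representation_eq[OF assms(3) that _ order_refl] assms(1,2)
    by (simp add: co_def sum.reindex)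
  have co_sum: "co (\<Sum>k\<in>E. a k *s e k) i = a i" if "i \<in> E" for a i
  proof -
    let ?x = "\<Sum>k\<in>E. a k *s e k"
    have "?x \<in> span (e ` E)" using span_image_finite_iff[OF assms(1)] by blast
    from sum_co[OF this] have "(\<Sum>k\<in>E. (co ?x k - a k) *s e k) = 0"
      by (simp add: scale_left_diff_distrib sum_subtractf)
    from independent_familyD[OF assms this that] show ?thesis by simp
  qed
  have span_co: "x \<in> span (e ` S) \<longleftrightarrow> (\<forall>i\<in>E - S. co x i = 0)" if x: "x \<in> span (e ` E)" and S: "S \<subseteq> E" for x S
  proof
    assume "x \<in> span (e ` S)"
    moreover have finS: "finite S" using S assms(1) finite_subset by blast
    ultimately obtain a where "x = (\<Sum>k\<in>S. a k *s e k)"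
      using span_image_finite_iff by blast
    also have "\<dots> = (\<Sum>k\<in>E. (if k \<in> S then a k else 0) *s e k)"
      using assms(1) S by (intro sum.mono_neutral_cong_left) auto
    finally show "\<forall>i\<in>E - S. co x i = 0" using co_sum by simp
  next
    assume "\<forall>i\<in>E - S. co x i = 0"
    then have "(\<Sum>i\<in>S. co x i *s e i) = x"
      using sum_co[OF x] assms(1) S by (subst sum.mono_neutral_left[of E]) auto
    moreover have "(\<Sum>i\<in>S. co x i *s e i) \<in> span (e ` S)"
      by (intro span_sum span_scale span_base imageI)
    ultimately show "x \<in> span (e ` S)" by simp
  qed
  have add_co: "co (x + y) i = co x i + co y i" if "x \<in> span (e ` E)" "y \<in> span (e ` E)" for x y i
    using that assms(3) by (simp add: co_def representation_add)
  have scale_co: "co (r *s x) i = r * co x i" if "x \<in> span (e ` E)" for r x i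
    using that assms(3) by (simp add: co_def representation_scale)
  show ?thesis by (rule that[OF add_co scale_co co_sum span_co])
qed

section \<open>Cosets as vectors of a quotient space\<close>

lemma coset_eq_iff:
  assumes "subspace W"
  shows "x +o W = y +o W \<longleftrightarrow> x - y \<in> W"
proof
  assume "x +o W = y +o W"
  moreover have "x \<in> x +o W" using subspace_0[OF assms] by (force simp: elt_set_plus_def)
  ultimately show "x - y \<in> W" by (auto simp: elt_set_plus_def)
next
  assume xy: "x - y \<in> W"
  have "\<exists>w'\<in>W. x + w = y + w'" if "w \<in> W" for w
    using subspace_add[OF assms xy that] by (intro bexI[of _ "x - y + w"]) auto
  moreover have "\<exists>w'\<in>W. y + w = x + w'" if "w \<in> W" for w
    using subspace_diff[OF assms that xy] by (intro bexI[of _ "w - (x - y)"]) auto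
  ultimately show "x +o W = y +o W" by (auto simp: elt_set_plus_def)
qed

lemma coset_plus_subspace:
  assumes "subspace W" "subspace W'" "W \<subseteq> W'"
  shows "(x +o W) + W' = x +o W'"
proof (intro equalityI subsetI)
  fix y assume "y \<in> (x +o W) + W'"
  then obtain w w' where "w \<in> W" "w' \<in> W'" "y = x + w + w'"
    by (auto simp: elt_set_plus_def set_plus_def)
  moreover then have "w + w' \<in> W'" using assms by (auto intro: subspace_add)
  ultimately show "y \<in> x +o W'" by (auto simp: elt_set_plus_def add.assoc)
next
  fix y assume "y \<in> x +o W'"
  then obtain w' where "w' \<in> W'" "y = x + 0 + w'" by (auto simp: elt_set_plus_def)
  then show "y \<in> (x +o W) + W'"
    using subspace_0[OF assms(1)] unfolding elt_set_plus_def set_plus_def by blast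
qed

lemma coset_plus:
  assumes "subspace W"
  shows "(x +o W) + (y +o W) = (x + y) +o W"
proof -
  have "W + W = W"
    using coset_plus_subspace[OF assms assms order_refl, of 0] by simp
  then show ?thesis by (simp add: set_plus_rearrange)
qed

lemma coset_scale:
  assumes "subspace W"
  shows "scale r ` (x +o W) + W = (r *s x) +o W"
proof (intro equalityI subsetI)
  fix y assume "y \<in> scale r ` (x +o W) + W"
  then obtain w w' where "w \<in> W" "w' \<in> W" "y = r *s (x + w) + w'"
    by (auto simp: elt_set_plus_def set_plus_def)
  moreover then have "r *s w + w' \<in> W"
    using assms by (auto intro: subspace_add subspace_scale)
  ultimately show "y \<in> (r *s x) +o W"
    by (auto simp: elt_set_plus_def algebra_simps)
next
  fix y assume "y \<in> (r *s x) +o W"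
  then obtain w where "w \<in> W" "y = r *s (x + 0) + w" by (auto simp: elt_set_plus_def)
  then show "y \<in> scale r ` (x +o W) + W"
    using subspace_0[OF assms] unfolding elt_set_plus_def set_plus_def by blast
qed

end

section \<open>Solutions of homogeneous linear systems\<close>

lemma homogeneous_system_nontrivial_solution:
  fixes c :: "'j \<Rightarrow> 'i \<Rightarrow> 'k::field"
  assumes "finite N" "finite S" "card N < card S"
  shows "\<exists>a. (\<exists>i\<in>S. a i \<noteq> 0) \<and> (\<forall>j\<in>N. (\<Sum>i\<in>S. a i * c j i) = 0)"
  using assms
proof (induction N arbitrary: S c rule: finite_induct)
  case empty
  then show ?case by (intro exI[of _ "\<lambda>_. 1"]) (auto simp: card_gt_0_iff)
next
  case (insert l N)
  show ?case
  proof (cases "\<forall>i\<in>S. c l i = 0")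
    case True
    then show ?thesis using insert.IH[OF insert.prems(1), of c] insert.prems insert.hyps by auto
  next
    case False
    then obtain p where p: "p \<in> S" "c l p \<noteq> 0" by blast
    \<comment> \<open>Equation \<open>l\<close> with pivot \<open>p\<close> eliminates the variable
      \<open>p\<close> from the other equations.\<close>
    define c' where "c' j i = c j i - c j p * c l i / c l p" for j i
    have "card N < card (S - {p})" using insert p(1) by simp
    then obtain a where a: "\<exists>i\<in>S - {p}. a i \<noteq> 0" "\<And>j. j \<in> N \<Longrightarrow> (\<Sum>i\<in>S - {p}. a i * c' j i) = 0"
      using insert.IH[of "S - {p}" c'] insert.prems(1) by auto
    \<comment> \<open>The value at \<open>p\<close> is the one that solves equation
      \<open>l\<close>.\<close>
    define b where "b = a(p := - (\<Sum>i\<in>S - {p}. a i * c l i) / c l p)"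
    have sum: "(\<Sum>i\<in>S. b i * c j i) =
        (\<Sum>i\<in>S - {p}. a i * c j i) - (\<Sum>i\<in>S - {p}. a i * c l i) / c l p * c j p" for j
    proof -
      have "(\<Sum>i\<in>S - {p}. b i * c j i) = (\<Sum>i\<in>S - {p}. a i * c j i)"
        by (intro sum.cong) (auto simp: b_def)
      then show ?thesis
        using sum.remove[OF insert.prems(1) p(1), of "\<lambda>i. b i * c j i"] by (simp add: b_def)
    qed
    have "(\<Sum>i\<in>S. b i * c j i) = 0" if "j \<in> insert l N" for j
    proof (cases "j = l")
      case True
      then show ?thesis using p(2) by (simp add: sum)
    next
      case False
      then have "0 = (\<Sum>i\<in>S - {p}. a i * c' j i)" using a(2) that by simp
      also have "\<dots> = (\<Sum>i\<in>S. b i * c j i)"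
        by (simp add: sum c'_def right_diff_distrib sum_subtractf sum_distrib_left sum_divide_distrib mult_ac)
      finally show ?thesis by simp
    qed
    moreover have "\<exists>i\<in>S. b i \<noteq> 0" using a(1) by (auto simp: b_def)
    ultimately show ?thesis by blast
  qed
qed

text \<open>In the box lemma, \<open>a\<close> lists coefficients on the \<open>m\<close> copies of
  a bar, and \<open>L a j\<close> is the coordinate of the resulting element on bar
  \<open>j\<close>. Linearity reduces the claim to \<open>card N\<close> equations in
  \<open>m\<close> unknowns.\<close>

lemma functionals_common_zero:
  fixes L :: "(nat \<Rightarrow> 'k::field) \<Rightarrow> 'j \<Rightarrow> 'k"
  assumes "finite N" "card N < m"
    and add: "\<And>a a' j. j \<in> N \<Longrightarrow> L (\<lambda>i. a i + a' i) j = L a j + L a' j"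
    and scale: "\<And>r a j. j \<in> N \<Longrightarrow> L (\<lambda>i. r * a i) j = r * L a j"
  shows "\<exists>a. (\<exists>i<m. a i \<noteq> 0) \<and> (\<forall>j\<in>N. L a j = 0)"
proof -
  define u where "u k = (\<lambda>i. if i = k then 1 else 0 :: 'k)" for k :: nat
  have L: "L (\<lambda>i. if i \<in> S then a i else 0) j = (\<Sum>k\<in>S. a k * L (u k) j)"
    if "finite S" "j \<in> N" for a S j
    using that(1)
  proof (induction S rule: finite_induct)
    case empty
    then show ?case using scale[OF that(2), of 0] by simp
  next
    case (insert k S)
    have "(\<lambda>i. if i \<in> insert k S then a i else 0) = (\<lambda>i. a k * u k i + (if i \<in> S then a i else 0))"
      using insert.hyps by (auto simp: u_def)
    then show ?case
      using insert add[OF that(2)] scale[OF that(2)] by simp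
  qed
  obtain a where a: "\<exists>i\<in>{..<m}. a i \<noteq> 0" "\<forall>j\<in>N. (\<Sum>i\<in>{..<m}. a i * L (u i) j) = 0"
    using homogeneous_system_nontrivial_solution[OF assms(1), of "{..<m}" "\<lambda>j i. L (u i) j"] assms(2) by auto
  \<comment> \<open>Only functions supported below \<open>m\<close> are combinations of the
    \<open>u k\<close> with \<open>k < m\<close>, so the solution is cut off there.\<close>
  then show ?thesis
    using L[of "{..<m}"] by (intro exI[of _ "\<lambda>i. if i \<in> {..<m} then a i else 0"]) auto
qed

section \<open>Normal form of a filtered complex\<close>

context vector_space
begin

text \<open>Triangularity: modulo vectors of the same degree that are present by time
  \<open>\<phi> \<sigma>\<close>, the new basis vector is \<open>u \<sigma>\<close>, so using it in
  place of \<open>u \<sigma>\<close> changes no level span.\<close>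

lemma span_levels_insert:
  fixes deg :: "'i \<Rightarrow> nat" and \<phi> :: "'i \<Rightarrow> real"
  defines "lev \<equiv> \<lambda>K m t. {\<tau>\<in>K. deg \<tau> = m \<and> \<phi> \<tau> \<le> t}"
  assumes "\<sigma> \<notin> S"
    and levS: "\<And>m t. span (e ` lev S m t) = span (u ` lev S m t)"
    and s': "s' - u \<sigma> \<in> span (u ` lev S (deg \<sigma>) (\<phi> \<sigma>))"
  shows "span (e(\<sigma> := s') ` lev (insert \<sigma> S) m t) = span (u ` lev (insert \<sigma> S) m t)"
proof -
  have same: "e(\<sigma> := s') ` lev S m t = e ` lev S m t"
    using assms(2) by (auto simp: lev_def image_iff)
  show ?thesis
  proof (cases "deg \<sigma> = m \<and> \<phi> \<sigma> \<le> t")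
    case True
    then have L: "lev (insert \<sigma> S) m t = insert \<sigma> (lev S m t)" by (auto simp: lev_def)
    have "lev S (deg \<sigma>) (\<phi> \<sigma>) \<subseteq> lev S m t" using True by (auto simp: lev_def)
    then have "s' - u \<sigma> \<in> span (u ` lev S m t)" using s' by (meson image_mono span_mono subsetD)
    then have "span (insert s' (e ` lev S m t)) = span (insert (u \<sigma>) (e ` lev S m t))"
      by (intro eq_span_insert_eq) (simp add: levS)
    also have "\<dots> = span (insert (u \<sigma>) (u ` lev S m t))"
      by (simp add: span_insert levS)
    finally show ?thesis unfolding L image_insert same by simp
  next
    case False
    then have L: "lev (insert \<sigma> S) m t = lev S m t" by (auto simp: lev_def)
    show ?thesis by (simp only: L same levS)
  qed
qed

text \<open>Known as Barannikov's canonical form; the proof is the persistence algorithm.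
  \<open>N\<close> collects the indices whose arrival kills a class, and \<open>p q\<close> is the
  index of the class that \<open>q\<close> kills. Indices outside \<open>N\<close> that
  \<open>p\<close> does not reach carry the classes that live forever.\<close>

theorem filtered_complex_normal_form:
  fixes u :: "'i \<Rightarrow> 'b" and deg :: "'i \<Rightarrow> nat" and \<phi> :: "'i \<Rightarrow> real"
  defines "lev \<equiv> \<lambda>K m t. {\<tau>\<in>K. deg \<tau> = m \<and> \<phi> \<tau> \<le> t}"
  assumes D: "Vector_Spaces.linear scale scale D"
    and "finite K" "inj_on u K" "independent (u ` K)"
    and "\<And>x. D (D x) = 0"
    and "\<And>\<sigma>. \<sigma> \<in> K \<Longrightarrow> D (u \<sigma>) \<in> span (u ` {\<tau>\<in>K. Suc (deg \<tau>) = deg \<sigma> \<and> \<phi> \<tau> \<le> \<phi> \<sigma>})"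
  shows "\<exists>e N p. inj_on e K \<and> independent (e ` K) \<and>
      (\<forall>m t. span (e ` lev K m t) = span (u ` lev K m t)) \<and>
      N \<subseteq> K \<and> inj_on p N \<and>
      (\<forall>q\<in>N. p q \<in> K - N \<and> Suc (deg (p q)) = deg q \<and> D (e q) = e (p q)) \<and>
      (\<forall>q\<in>K - N. D (e q) = 0)"
proof -
  interpret D: Vector_Spaces.linear scale scale D by fact
  \<comment> \<open>The induction has to track only the level spans: each index lies in its own
    level, so equal level spans give equal total spans, and counting makes \<open>e\<close> a
    basis.\<close>
  have levels_basis: "inj_on e K \<and> independent (e ` K)"
    if "finite K" "inj_on u K" "independent (u ` K)"
      "\<And>m t. span (e ` lev K m t) = span (u ` lev K m t)" for e K
  proof -
    have sub: "f ` K \<subseteq> span (g ` K)"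
      if "\<And>m t. span (f ` lev K m t) = span (g ` lev K m t)" for f g :: "'i \<Rightarrow> 'b"
    proof
      fix x assume "x \<in> f ` K"
      then obtain \<tau> where "\<tau> \<in> K" "x = f \<tau>" by blast
      then have "x \<in> span (f ` lev K (deg \<tau>) (\<phi> \<tau>))" by (auto simp: lev_def intro!: span_base)
      then have "x \<in> span (g ` lev K (deg \<tau>) (\<phi> \<tau>))" by (simp add: that)
      moreover have "g ` lev K (deg \<tau>) (\<phi> \<tau>) \<subseteq> g ` K" by (auto simp: lev_def)
      ultimately show "x \<in> span (g ` K)" using span_mono by blast
    qed
    have "span (e ` K) = span (u ` K)"
      using sub[of e u] sub[of u e] that(4) by (simp add: span_eq)
    then show ?thesis using independent_family_if_same_span that by blast
  qed
  \<comment> \<open>Indices are added by time, ties broken by degree. Hence \<open>\<sigma>\<close>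
    is not among the terms allowed in the boundary of an earlier element, and \<open>S\<close> alone
    satisfies the hypotheses.\<close>
  show ?thesis using assms(3-5,7)
  proof (induction K rule: finite_ranking_induct[where f = "\<lambda>\<sigma>. (\<phi> \<sigma>, deg \<sigma>)"])
    case empty
    show ?case by (rule exI, rule exI[of _ "{}"]) (auto simp: lev_def independent_empty)
  next
    case (insert \<sigma> S)
    show ?case
    proof (cases "\<sigma> \<in> S")
      case True
      then show ?thesis using insert by (simp add: insert_absorb)
    next
      case \<sigma>: False
      have top: "\<phi> \<rho> < \<phi> \<sigma> \<or> \<phi> \<rho> = \<phi> \<sigma> \<and> deg \<rho> \<le> deg \<sigma>" if "\<rho> \<in> S" for \<rho>
        using insert.hyps(2)[OF that] by (auto simp: less_eq_prod_def)
      have top': "\<phi> \<rho> \<le> \<phi> \<sigma>" if "\<rho> \<in> S" for \<rho> using top[OF that] by auto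
      have uS: "inj_on u S" "independent (u ` S)"
        using insert.prems independent_mono[of "u ` insert \<sigma> S"] by auto
      have DS: "D (u \<rho>) \<in> span (u ` {\<tau>\<in>S. Suc (deg \<tau>) = deg \<rho> \<and> \<phi> \<tau> \<le> \<phi> \<rho>})" if "\<rho> \<in> S" for \<rho>
      proof -
        have "{\<tau>\<in>insert \<sigma> S. Suc (deg \<tau>) = deg \<rho> \<and> \<phi> \<tau> \<le> \<phi> \<rho>} = {\<tau>\<in>S. Suc (deg \<tau>) = deg \<rho> \<and> \<phi> \<tau> \<le> \<phi> \<rho>}"
          using top[OF that] by auto
        then show ?thesis using insert.prems(3)[of \<rho>] that by simp
      qed
      obtain e N p where e: "inj_on e S" "independent (e ` S)"
        and lev: "\<And>m t. span (e ` lev S m t) = span (u ` lev S m t)"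
        and N: "N \<subseteq> S" "inj_on p N"
        and p: "\<And>q. q \<in> N \<Longrightarrow> p q \<in> S - N" "\<And>q. q \<in> N \<Longrightarrow> Suc (deg (p q)) = deg q"
        and De: "\<And>q. q \<in> N \<Longrightarrow> D (e q) = e (p q)" "\<And>q. q \<in> S - N \<Longrightarrow> D (e q) = 0"
        using insert.IH[OF uS DS] by blast
      \<comment> \<open>\<open>\<sigma>\<close> comes last, so \<open>P\<close> carries no time
        bound and still collects exactly the terms allowed in \<open>D (u \<sigma>)\<close>.\<close>
      define P where "P = {\<tau>\<in>S. Suc (deg \<tau>) = deg \<sigma>}"
      have finS: "finite S" by fact
      have finP: "finite P" using finS by (simp add: P_def)
      have "span (e ` P) = span (u ` P)"
      proof (cases "deg \<sigma>")
        case 0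
        then show ?thesis by (simp add: P_def)
      next
        case (Suc m)
        then have "P = lev S m (\<phi> \<sigma>)" using top' by (auto simp: P_def lev_def)
        then show ?thesis using lev by simp
      qed
      moreover have "{\<tau>\<in>insert \<sigma> S. Suc (deg \<tau>) = deg \<sigma> \<and> \<phi> \<tau> \<le> \<phi> \<sigma>} = P"
        using top' by (auto simp: P_def)
      then have "D (u \<sigma>) \<in> span (u ` P)" using insert.prems(3)[of \<sigma>] by simp
      ultimately obtain a where a: "D (u \<sigma>) = (\<Sum>\<tau>\<in>P. a \<tau> *s e \<tau>)"
        using span_image_finite_iff[OF finP] by metis
      \<comment> \<open>Subtracting multiples of the \<open>e q\<close> removes the part of \<open>D (u \<sigma>)\<close> that already bounds.\<close>
      define Q where "Q = {q\<in>N. p q \<in> P}"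
      have QS: "Q \<subseteq> S" "finite Q" using N finS by (auto simp: Q_def intro: finite_subset)
      \<comment> \<open>\<open>R\<close> indexes the cycles of degree one less than
        \<open>\<sigma>\<close> that no paired element bounds yet.\<close>
      define R where "R = P - p ` N - N"
      define s' where "s' = u \<sigma> - (\<Sum>q\<in>Q. a (p q) *s e q)"
      \<comment> \<open>\<open>D (D (u \<sigma>)) = 0\<close> is a relation among the vectors
        \<open>e (p \<tau>)\<close> with \<open>\<tau>\<close> in \<open>P \<inter> N\<close>. These
        are distinct members of a basis, so the coefficients on non-cycles vanish.\<close>
      have aN: "a \<tau> = 0" if "\<tau> \<in> P \<inter> N" for \<tau>
      proof -
        have "0 = D (D (u \<sigma>))" by (simp add: assms(6))
        also have "\<dots> = (\<Sum>\<tau>\<in>P. a \<tau> *s D (e \<tau>))" by (simp add: a D.sum D.scale)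
        also have "\<dots> = (\<Sum>\<tau>\<in>P \<inter> N. a \<tau> *s (e \<circ> p) \<tau>)"
          using finP De P_def by (intro sum.mono_neutral_cong_right) auto
        finally have z: "(\<Sum>\<tau>\<in>P \<inter> N. a \<tau> *s (e \<circ> p) \<tau>) = 0" by simp
        have "inj_on (e \<circ> p) (P \<inter> N)"
          using N(2) e(1) p(1) by (intro comp_inj_on) (auto intro: inj_on_subset)
        moreover have "independent ((e \<circ> p) ` (P \<inter> N))"
          using p(1) by (intro independent_mono[OF e(2)]) auto
        ultimately show ?thesis
          using independent_familyD[of "P \<inter> N" "e \<circ> p" a \<tau>] z that finP by blast
      qed
      have pQ: "p ` Q = P \<inter> p ` N" by (auto simp: Q_def)
      have Ds': "D s' = (\<Sum>\<tau>\<in>R. a \<tau> *s e \<tau>)"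
      proof -
        have "D (\<Sum>q\<in>Q. a (p q) *s e q) = (\<Sum>q\<in>Q. a (p q) *s e (p q))"
          using De by (simp add: D.sum D.scale Q_def)
        also have "\<dots> = (\<Sum>\<tau>\<in>P \<inter> p ` N. a \<tau> *s e \<tau>)"
          using N(2) unfolding pQ[symmetric]
          by (subst sum.reindex) (auto simp: Q_def intro: inj_on_subset)
        finally have "D s' = (\<Sum>\<tau>\<in>P. a \<tau> *s e \<tau>) - (\<Sum>\<tau>\<in>P \<inter> p ` N. a \<tau> *s e \<tau>)"
          by (simp add: s'_def D.diff a)
        also have "\<dots> = (\<Sum>\<tau>\<in>P - p ` N. a \<tau> *s e \<tau>)"
          using sum.Int_Diff[OF finP, of "\<lambda>\<tau>. a \<tau> *s e \<tau>" "p ` N"] by simp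
        also have "\<dots> = (\<Sum>\<tau>\<in>R. a \<tau> *s e \<tau>)"
          using finP aN unfolding R_def by (intro sum.mono_neutral_right) auto
        finally show ?thesis .
      qed
      \<comment> \<open>Every \<open>q\<close> in \<open>Q\<close> has the degree of
        \<open>\<sigma>\<close> and arrives no later, which keeps \<open>s'\<close> in triangular
        form.\<close>
      have "(\<Sum>q\<in>Q. a (p q) *s e q) \<in> span (e ` lev S (deg \<sigma>) (\<phi> \<sigma>))"
        using QS p(2) top' by (intro span_sum span_scale span_base) (auto simp: Q_def P_def lev_def)
      then have s'u: "s' - u \<sigma> \<in> span (u ` lev S (deg \<sigma>) (\<phi> \<sigma>))"
        by (simp add: s'_def lev span_neg)
      note levels = span_levels_insert[OF \<sigma>, where deg = deg and \<phi> = \<phi> and u = u]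
      note basis = levels_basis[OF finite.insertI[OF finS] insert.prems(1,2)]
      show ?thesis
      proof (cases "\<forall>\<tau>\<in>R. a \<tau> = 0")
        case True
        \<comment> \<open>\<open>\<sigma>\<close> gives birth: \<open>s'\<close> is a new cycle, and
          \<open>N\<close> and \<open>p\<close> stay as they are.\<close>
        define e2 where "e2 = e(\<sigma> := s')"
        have lev2: "span (e2 ` lev (insert \<sigma> S) m t) = span (u ` lev (insert \<sigma> S) m t)" for m t
          using lev s'u unfolding lev_def e2_def by (rule levels)
        have Ds0: "D s' = 0" using True by (simp add: Ds')
        have "\<forall>q\<in>N. p q \<in> insert \<sigma> S - N \<and> Suc (deg (p q)) = deg q \<and> D (e2 q) = e2 (p q)"
        proof
          fix q assume q: "q \<in> N"
          then have "q \<noteq> \<sigma>" "p q \<noteq> \<sigma>" using N(1) p(1) \<sigma> by auto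
          then show "p q \<in> insert \<sigma> S - N \<and> Suc (deg (p q)) = deg q \<and> D (e2 q) = e2 (p q)"
            using p[OF q] De(1)[OF q] by (simp add: e2_def)
        qed
        moreover have "\<forall>q\<in>insert \<sigma> S - N. D (e2 q) = 0"
          using Ds0 De(2) by (auto simp: e2_def)
        moreover have "N \<subseteq> insert \<sigma> S" using N(1) by blast
        moreover have "\<forall>m t. span (e2 ` lev (insert \<sigma> S) m t) = span (u ` lev (insert \<sigma> S) m t)"
          using lev2 by blast
        ultimately show ?thesis using conjunct1[OF basis[OF lev2]] conjunct2[OF basis[OF lev2]] N(2)
          by (intro exI[of _ e2] exI[of _ N] exI[of _ p] conjI)
      next
        case False
        define R0 where "R0 = {\<tau>\<in>R. a \<tau> \<noteq> 0}"
        have R0: "finite R0" "R0 \<noteq> {}" using False finP by (auto simp: R0_def R_def)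
        \<comment> \<open>The elder rule: the youngest cycle in \<open>D s'\<close> dies, and \<open>D s'\<close> may replace it
          because all other terms are at least as old.\<close>
        have "Max (\<phi> ` R0) \<in> \<phi> ` R0" using R0 by simp
        then obtain j where "j \<in> R0" "\<phi> j = Max (\<phi> ` R0)" by auto
        then have j: "j \<in> R0" "\<And>\<tau>. \<tau> \<in> R0 \<Longrightarrow> \<phi> \<tau> \<le> \<phi> j"
          using R0 by simp_all
        \<comment> \<open>\<open>j\<close> neither kills a class nor is already killed, so replacing
          \<open>e j\<close> disturbs no earlier pair.\<close>
        have jS: "j \<in> S" "j \<notin> N" "j \<notin> p ` N" "Suc (deg j) = deg \<sigma>" "a j \<noteq> 0" "j \<noteq> \<sigma>"
          using j(1) \<sigma> by (auto simp: R0_def R_def P_def)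
        define w where "w = D s'"
        have "w = (\<Sum>\<tau>\<in>R0. a \<tau> *s e \<tau>)"
          unfolding w_def Ds' using finP by (intro sum.mono_neutral_right) (auto simp: R0_def R_def)
        then have w: "w - a j *s e j = (\<Sum>\<tau>\<in>R0 - {j}. a \<tau> *s e \<tau>)"
          using j(1) R0(1) by (simp add: sum.remove)
        have lev1: "span (e(j := w) ` lev S m t) = span (u ` lev S m t)" for m t
        proof (cases "j \<in> lev S m t")
          case True
          define X where "X = e ` (lev S m t - {j})"
          have "R0 - {j} \<subseteq> lev S m t - {j}"
            using True j(2) jS(4) by (auto simp: lev_def R0_def R_def P_def intro: order_trans)
          then have "w - a j *s e j \<in> span X"
            unfolding w X_def by (intro span_sum span_scale span_base) auto
          then have "span (insert w X) = span (insert (e j) X)"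
            using jS(5) by (rule span_insert_replace[rotated])
          moreover have "e(j := w) ` lev S m t = insert w X"
            using True by (auto simp: X_def image_iff)
          moreover have "e ` lev S m t = insert (e j) X"
            using True by (auto simp: X_def image_iff)
          ultimately show ?thesis using lev by metis
        next
          case False
          then have "e(j := w) ` lev S m t = e ` lev S m t" by (auto simp: image_iff)
          then show ?thesis using lev by simp
        qed
        define e2 where "e2 = (e(j := w))(\<sigma> := s')"
        have lev2: "span (e2 ` lev (insert \<sigma> S) m t) = span (u ` lev (insert \<sigma> S) m t)" for m t
          using lev1 s'u unfolding e2_def lev_def by (rule levels)
        have e2: "e2 \<sigma> = s'" "e2 j = w" "\<And>q. q \<noteq> \<sigma> \<Longrightarrow> q \<noteq> j \<Longrightarrow> e2 q = e q"
          using jS by (auto simp: e2_def)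
        define p2 where "p2 = p(\<sigma> := j)"
        have "inj_on p2 (insert \<sigma> N)"
          using N jS \<sigma> by (auto simp: inj_on_def p2_def)
        moreover have "\<forall>q\<in>insert \<sigma> N. p2 q \<in> insert \<sigma> S - insert \<sigma> N \<and>
            Suc (deg (p2 q)) = deg q \<and> D (e2 q) = e2 (p2 q)"
        proof
          fix q assume q: "q \<in> insert \<sigma> N"
          show "p2 q \<in> insert \<sigma> S - insert \<sigma> N \<and>
            Suc (deg (p2 q)) = deg q \<and> D (e2 q) = e2 (p2 q)"
          proof (cases "q = \<sigma>")
            case True
            then show ?thesis using jS e2 by (simp add: w_def p2_def)
          next
            case False
            then have "q \<in> N" using q by simp
            moreover then have "q \<noteq> j" "p q \<noteq> j" "p q \<noteq> \<sigma>" using jS p(1) \<sigma> by auto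
            ultimately show ?thesis using False p De e2 by (auto simp: p2_def)
          qed
        qed
        moreover have "\<forall>q\<in>insert \<sigma> S - insert \<sigma> N. D (e2 q) = 0"
        proof
          fix q assume q: "q \<in> insert \<sigma> S - insert \<sigma> N"
          then show "D (e2 q) = 0"
            using De(2)[of q] e2 assms(6) by (cases "q = j") (auto simp: w_def)
        qed
        moreover have "insert \<sigma> N \<subseteq> insert \<sigma> S" using N(1) by blast
        moreover have "\<forall>m t. span (e2 ` lev (insert \<sigma> S) m t) = span (u ` lev (insert \<sigma> S) m t)"
          using lev2 by blast
        ultimately show ?thesis using conjunct1[OF basis[OF lev2]] conjunct2[OF basis[OF lev2]]
          by (intro exI[of _ e2] exI[of _ "insert \<sigma> N"] exI[of _ p2] conjI)
      qed
    qed
  qed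
qed

end

section \<open>Simplicial chains and homology\<close>

lemma lookup_chain_scale [simp]:
  "Poly_Mapping.lookup (chain_scale r x) \<sigma> = r * Poly_Mapping.lookup x \<sigma>"
  by (simp add: chain_scale_def map.rep_eq when_def)

interpretation chain: vector_space chain_scale
  by standard (auto intro!: poly_mapping_eqI simp: lookup_add algebra_simps)

abbreviation elem_chain :: "'v set \<Rightarrow> ('v set \<Rightarrow>\<^sub>0 'k::field)" where
  "elem_chain \<sigma> \<equiv> Poly_Mapping.single \<sigma> 1"

lemma chain_scale_single: "chain_scale r (Poly_Mapping.single \<sigma> s) = Poly_Mapping.single \<sigma> (r * s)"
  by (rule poly_mapping_eqI) (simp add: lookup_single when_def)

lemma chain_eq_sum:
  assumes "finite S" "Poly_Mapping.keys x \<subseteq> S"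
  shows "x = (\<Sum>\<sigma>\<in>S. chain_scale (Poly_Mapping.lookup x \<sigma>) (elem_chain \<sigma>))"
proof (rule poly_mapping_eqI)
  fix \<tau>
  have "Poly_Mapping.lookup (\<Sum>\<sigma>\<in>S. chain_scale (Poly_Mapping.lookup x \<sigma>) (elem_chain \<sigma>)) \<tau>
    = (\<Sum>\<sigma>\<in>S. if \<sigma> = \<tau> then Poly_Mapping.lookup x \<tau> else 0)"
    by (auto simp: lookup_sum lookup_single when_def intro: sum.cong)
  also have "\<dots> = Poly_Mapping.lookup x \<tau>"
    using assms by (auto simp: in_keys_iff)
  finally show "Poly_Mapping.lookup x \<tau> =
      Poly_Mapping.lookup (\<Sum>\<sigma>\<in>S. chain_scale (Poly_Mapping.lookup x \<sigma>) (elem_chain \<sigma>)) \<tau>"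
    by simp
qed

lemma inj_elem_chain: "inj_on (elem_chain :: _ \<Rightarrow> 'v set \<Rightarrow>\<^sub>0 'k::field) S"
proof (rule inj_onI)
  fix \<sigma> \<tau> :: "'v set"
  assume "elem_chain \<sigma> = (elem_chain \<tau> :: 'v set \<Rightarrow>\<^sub>0 'k)"
  then have "Poly_Mapping.lookup (elem_chain \<sigma> :: 'v set \<Rightarrow>\<^sub>0 'k) \<sigma> = Poly_Mapping.lookup (elem_chain \<tau>) \<sigma>"
    by simp
  then show "\<sigma> = \<tau>" by (simp add: lookup_single when_def split: if_splits)
qed

lemma independent_elem_chain:
  assumes "finite K"
  shows "chain.independent (elem_chain ` K :: ('v set \<Rightarrow>\<^sub>0 'k::field) set)"
proof (rule chain.independent_if_scalars_zero)
  fix f :: "_ \<Rightarrow> 'k" and x :: "'v set \<Rightarrow>\<^sub>0 'k"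
  assume sum: "(\<Sum>x\<in>elem_chain ` K. chain_scale (f x) x) = 0" and "x \<in> elem_chain ` K"
  then obtain \<tau> where \<tau>: "\<tau> \<in> K" "x = elem_chain \<tau>" by blast
  have "0 = Poly_Mapping.lookup (\<Sum>\<sigma>\<in>K. chain_scale (f (elem_chain \<sigma>)) (elem_chain \<sigma>)) \<tau>"
    using sum by (simp add: sum.reindex inj_elem_chain)
  also have "\<dots> = (\<Sum>\<sigma>\<in>K. if \<sigma> = \<tau> then f (elem_chain \<tau>) else 0)"
    by (auto simp: lookup_sum lookup_single when_def intro: sum.cong)
  also have "\<dots> = f x" using \<tau> assms by simp
  finally show "f x = 0" by simp
qed (use assms in simp)

lemma subspace_chains: "chain.subspace (chains n S)"
  unfolding chain.subspace_def chains_def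
  by (auto simp: in_keys_iff lookup_add subset_iff) (metis add_0)+

lemma chains_eq_span:
  assumes "finite K" "S \<subseteq> K"
  shows "(chains n S :: ('v set \<Rightarrow>\<^sub>0 'k::field) set) = chain.span (elem_chain ` {\<sigma>\<in>S. card \<sigma> = n + 1})"
proof (intro equalityI subsetI)
  fix x :: "'v set \<Rightarrow>\<^sub>0 'k"
  assume "x \<in> chains n S"
  then have "Poly_Mapping.keys x \<subseteq> {\<sigma>\<in>S. card \<sigma> = n + 1}" by (simp add: chains_def)
  moreover have "finite {\<sigma>\<in>S. card \<sigma> = n + 1}" using assms by (simp add: finite_subset)
  ultimately show "x \<in> chain.span (elem_chain ` {\<sigma>\<in>S. card \<sigma> = n + 1})"
    using chain.span_image_finite_iff chain_eq_sum by blast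
next
  fix x :: "'v set \<Rightarrow>\<^sub>0 'k"
  have "elem_chain ` {\<sigma>\<in>S. card \<sigma> = n + 1} \<subseteq> (chains n S :: ('v set \<Rightarrow>\<^sub>0 'k) set)"
    by (auto simp: chains_def)
  then show "x \<in> chain.span (elem_chain ` {\<sigma>\<in>S. card \<sigma> = n + 1}) \<Longrightarrow> x \<in> chains n S"
    using chain.span_minimal[OF _ subspace_chains] by blast
qed

section \<open>The boundary operator and its square\<close>

definition face_sign :: "'v::linorder set \<Rightarrow> 'v \<Rightarrow> 'k::field" where
  "face_sign \<sigma> v = (-1) ^ card {u\<in>\<sigma>. u < v}"

definition elem_boundary :: "'v::linorder set \<Rightarrow> ('v set \<Rightarrow>\<^sub>0 'k::field)" where
  "elem_boundary \<sigma> = (\<Sum>v\<in>{v\<in>\<sigma>. \<sigma> - {v} \<noteq> {}}. Poly_Mapping.single (\<sigma> - {v}) (face_sign \<sigma> v))"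

lemma boundary_eq_sum:
  assumes "finite S" "Poly_Mapping.keys x \<subseteq> S"
  shows "boundary x = (\<Sum>\<sigma>\<in>S. chain_scale (Poly_Mapping.lookup x \<sigma>) (elem_boundary \<sigma>))"
proof -
  have "boundary x = (\<Sum>\<sigma>\<in>Poly_Mapping.keys x. chain_scale (Poly_Mapping.lookup x \<sigma>) (elem_boundary \<sigma>))"
    by (simp add: boundary_def elem_boundary_def face_sign_def chain.scale_sum_right
        chain_scale_single mult.commute)
  also have "\<dots> = (\<Sum>\<sigma>\<in>S. chain_scale (Poly_Mapping.lookup x \<sigma>) (elem_boundary \<sigma>))"
    using assms by (intro sum.mono_neutral_left) (auto simp: in_keys_iff)
  finally show ?thesis .
qed

lemma linear_boundary: "Vector_Spaces.linear chain_scale chain_scale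
    (boundary :: ('v::linorder set \<Rightarrow>\<^sub>0 'k::field) \<Rightarrow> _)"
proof unfold_locales
  fix x y :: "'v set \<Rightarrow>\<^sub>0 'k" and r :: 'k
  let ?S = "Poly_Mapping.keys x \<union> Poly_Mapping.keys y"
  show "boundary (x + y) = boundary x + boundary y"
    using keys_add[of x y]
    by (simp add: boundary_eq_sum[of ?S] lookup_add chain.scale_left_distrib sum.distrib)
  have "Poly_Mapping.keys (chain_scale r x) \<subseteq> Poly_Mapping.keys x" by (auto simp: in_keys_iff)
  then show "boundary (chain_scale r x) = chain_scale r (boundary x)"
    by (simp add: boundary_eq_sum[of "Poly_Mapping.keys x"] chain.scale_sum_right)
qed

interpretation boundary: Vector_Spaces.linear chain_scale chain_scale boundary
  by (rule linear_boundary)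

lemma boundary_single: "boundary (Poly_Mapping.single \<sigma> c) = chain_scale c (elem_boundary \<sigma>)"
  by (subst boundary_eq_sum[of "{\<sigma>}"]) (auto simp: lookup_single)

text \<open>Deleting the smaller vertex \<open>u\<close> lowers the position of \<open>v\<close> by
  one, whereas deleting \<open>v\<close> leaves the position of \<open>u\<close> unchanged.\<close>

lemma face_sign_swap:
  assumes "finite \<sigma>" "u \<in> \<sigma>" "v \<in> \<sigma>" "u < v"
  shows "face_sign \<sigma> u * face_sign (\<sigma> - {u}) v = - (face_sign \<sigma> v * face_sign (\<sigma> - {v}) u :: 'k::field)"
proof -
  have "{w\<in>\<sigma> - {v}. w < u} = {w\<in>\<sigma>. w < u}" using assms by auto
  moreover have "{w\<in>\<sigma>. w < v} = insert u {w\<in>\<sigma> - {u}. w < v}" using assms by auto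
  then have "card {w\<in>\<sigma>. w < v} = Suc (card {w\<in>\<sigma> - {u}. w < v})" using assms by simp
  ultimately show ?thesis by (simp add: face_sign_def)
qed

text \<open>The terms are indexed by ordered pairs of deleted vertices. Swapping the pair changes
  the sign, so the double boundary equals its own negative, and characteristic 0 makes it
  vanish.\<close>

lemma boundary_elem_boundary:
  "boundary (elem_boundary \<sigma>) = (0 :: 'v::linorder set \<Rightarrow>\<^sub>0 'k::field_char_0)"
proof (cases "finite \<sigma>")
  case True
  define P where "P = (SIGMA v:{v\<in>\<sigma>. \<sigma> - {v} \<noteq> {}}. {u\<in>\<sigma> - {v}. \<sigma> - {v} - {u} \<noteq> {}})"
  define f :: "'v \<times> 'v \<Rightarrow> ('v set \<Rightarrow>\<^sub>0 'k)" where
    "f = (\<lambda>(v, u). Poly_Mapping.single (\<sigma> - {v} - {u}) (face_sign \<sigma> v * face_sign (\<sigma> - {v}) u))"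
  have fin: "finite P" using True by (auto simp: P_def)
  have "boundary (elem_boundary \<sigma>) = sum f P"
    using True
    by (subst elem_boundary_def)
       (simp add: boundary.sum boundary_single elem_boundary_def chain.scale_sum_right
        chain_scale_single P_def f_def sum.Sigma)
  moreover have "sum f P = (\<Sum>q\<in>P. f (prod.swap q))"
    by (rule sum.reindex_bij_witness[of _ prod.swap prod.swap]) (auto simp: P_def)
  moreover have "(\<Sum>q\<in>P. f q + f (prod.swap q)) = 0"
  proof (rule sum.neutral, safe)
    fix v u assume "(v, u) \<in> P"
    then have uv: "u \<in> \<sigma>" "v \<in> \<sigma>" "u \<noteq> v" by (auto simp: P_def)
    have "\<sigma> - {v} - {u} = \<sigma> - {u} - {v}" by auto
    then show "f (v, u) + f (prod.swap (v, u)) = 0"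
      using face_sign_swap[OF True, of u v, where 'k = 'k] face_sign_swap[OF True, of v u, where 'k = 'k] uv
      by (cases "u < v") (simp_all add: f_def single_add[symmetric])
  qed
  ultimately have *: "boundary (elem_boundary \<sigma>) + boundary (elem_boundary \<sigma>) = (0 :: 'v set \<Rightarrow>\<^sub>0 'k)"
    by (simp add: sum.distrib)
  show ?thesis
  proof (rule poly_mapping_eqI)
    fix k
    show "Poly_Mapping.lookup (boundary (elem_boundary \<sigma>)) k = Poly_Mapping.lookup (0 :: 'v set \<Rightarrow>\<^sub>0 'k) k"
      using arg_cong[OF *, of "\<lambda>x. Poly_Mapping.lookup x k"] by (simp add: lookup_add)
  qed
next
  case False
  \<comment> \<open>For infinite \<open>\<sigma>\<close> the defining sum has an infinite index set
    and is 0 by convention.\<close>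
  then have "infinite {v\<in>\<sigma>. \<sigma> - {v} \<noteq> {}}"
    by (metis (mono_tags, lifting) Collect_mem_eq Collect_mono finite.emptyI finite_Diff2 finite_insert rev_finite_subset)
  then show ?thesis by (simp add: elem_boundary_def boundary.zero)
qed

lemma boundary_boundary: "boundary (boundary x) = (0 :: 'v::linorder set \<Rightarrow>\<^sub>0 'k::field_char_0)"
  by (simp add: boundary_eq_sum[of "Poly_Mapping.keys x" x] boundary.sum boundary.scale boundary_elem_boundary)

section \<open>Cycles, boundaries and homology classes\<close>

lemma subspace_boundaries: "chain.subspace (boundaries n S)"
  unfolding boundaries_def by (rule boundary.subspace_image[OF subspace_chains])

lemma subspace_cycles: "chain.subspace (cycles n S)"
  using subspace_chains[of n S]
  by (auto simp: chain.subspace_def cycles_def boundary.add boundary.scale)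

lemma boundaries_mono: "S \<subseteq> T \<Longrightarrow> boundaries n S \<subseteq> boundaries n T"
  unfolding boundaries_def chains_def by blast

lemma cycles_mono: "S \<subseteq> T \<Longrightarrow> cycles n S \<subseteq> cycles n T"
  unfolding cycles_def chains_def by blast

lemma sublevel_mono: "s \<le> t \<Longrightarrow> sublevel K \<phi> s \<subseteq> sublevel K \<phi> t"
  by (auto simp: sublevel_def)

lemma homology_class_add:
  "(x +o boundaries n S) \<oplus>\<^bsub>homology n S\<^esub> (y +o boundaries n S) = (x + y) +o boundaries n S"
  by (simp add: homology_def chain.coset_plus subspace_boundaries)

lemma homology_class_scale:
  "r \<odot>\<^bsub>homology n S\<^esub> (x +o boundaries n S) = chain_scale r x +o boundaries n S"
  by (simp add: homology_def chain.coset_scale subspace_boundaries)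

lemma homology_class_inclusion:
  "S \<subseteq> T \<Longrightarrow> (x +o boundaries n S) + boundaries n T = x +o boundaries n T"
  by (intro chain.coset_plus_subspace subspace_boundaries boundaries_mono)

lemma carrier_homology: "carrier (homology n S) = (\<lambda>z. z +o boundaries n S) ` cycles n S"
  by (auto simp: homology_def)

text \<open>This is what the normal form demands of the boundary operator: faces lie in
  \<open>K\<close> by closure and enter no later by monotonicity.\<close>

lemma elem_boundary_in_span:
  assumes "finite_simplicial_complex K" "filtration_function K \<phi>" "\<sigma> \<in> K"
  shows "elem_boundary \<sigma> \<in> chain.span
    (elem_chain ` {\<tau>\<in>K. Suc (card \<tau>) = card \<sigma> \<and> \<phi> \<tau> \<le> \<phi> \<sigma>} :: ('v::linorder set \<Rightarrow>\<^sub>0 'k::field) set)"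
  unfolding elem_boundary_def
proof (rule chain.span_sum)
  fix v assume v: "v \<in> {v\<in>\<sigma>. \<sigma> - {v} \<noteq> {}}"
  have "finite \<sigma>" using assms(1,3) by (simp add: finite_simplicial_complex_def)
  have "\<tau> \<in> K" if "\<tau> \<subseteq> \<sigma>" "\<tau> \<noteq> {}" for \<tau>
    using assms(1,3) that unfolding finite_simplicial_complex_def by blast
  then have "\<sigma> - {v} \<in> K" using v by auto
  moreover then have "\<phi> (\<sigma> - {v}) \<le> \<phi> \<sigma>"
    using assms(2,3) unfolding filtration_function_def by blast
  moreover have "Suc (card (\<sigma> - {v})) = card \<sigma>"
    using v \<open>finite \<sigma>\<close> by (metis (no_types, lifting) card_Suc_Diff1 mem_Collect_eq)
  ultimately have "elem_chain (\<sigma> - {v}) \<in> elem_chain ` {\<tau>\<in>K. Suc (card \<tau>) = card \<sigma> \<and> \<phi> \<tau> \<le> \<phi> \<sigma>}"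
    by blast
  from chain.span_scale[OF chain.span_base[OF this], of "face_sign \<sigma> v"]
  show "Poly_Mapping.single (\<sigma> - {v}) (face_sign \<sigma> v :: 'k) \<in> chain.span
    (elem_chain ` {\<tau>\<in>K. Suc (card \<tau>) = card \<sigma> \<and> \<phi> \<tau> \<le> \<phi> \<sigma>})"
    by (simp add: chain_scale_single)
qed

text \<open>One basis serves all times at once: \<open>\<phi> \<tau>\<close> is the time when the
  cycle \<open>e \<tau>\<close> appears, and \<open>\<delta> \<tau>\<close> the time from which it
  bounds.\<close>

lemma persistence_basis_exists:
  fixes K :: "'v::linorder set set"
  assumes K: "finite_simplicial_complex K" and \<phi>: "filtration_function K \<phi>"
  obtains E and e :: "'v set \<Rightarrow> ('v set \<Rightarrow>\<^sub>0 'k::field_char_0)" and \<delta>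
  where "finite E" "inj_on e E" "chain.independent (e ` E)"
    and "\<And>t. cycles n (sublevel K \<phi> t) = chain.span (e ` {\<tau>\<in>E. \<phi> \<tau> \<le> t})"
    and "\<And>t. boundaries n (sublevel K \<phi> t) = chain.span (e ` {\<tau>\<in>E. \<delta> \<tau> \<le> ereal t})"
proof -
  have finK: "finite K" using K by (simp add: finite_simplicial_complex_def)
  define lev where "lev m t = {\<tau>\<in>K. card \<tau> = m \<and> \<phi> \<tau> \<le> t}" for m t
  have "boundary (elem_chain \<sigma>) \<in> chain.span
      (elem_chain ` {\<tau>\<in>K. Suc (card \<tau>) = card \<sigma> \<and> \<phi> \<tau> \<le> \<phi> \<sigma>} :: ('v set \<Rightarrow>\<^sub>0 'k) set)"
    if "\<sigma> \<in> K" for \<sigma>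
    using elem_boundary_in_span[OF K \<phi> that] by (simp add: boundary_single)
  from chain.filtered_complex_normal_form[OF linear_boundary finK inj_elem_chain
      independent_elem_chain[OF finK] boundary_boundary this, folded lev_def]
  obtain e :: "'v set \<Rightarrow> ('v set \<Rightarrow>\<^sub>0 'k)" and N p
    where e: "inj_on e K" "chain.independent (e ` K)"
      and levels: "\<And>m t. chain.span (e ` lev m t) = chain.span (elem_chain ` lev m t)"
      and N: "N \<subseteq> K" "inj_on p N"
      and p: "\<And>q. q \<in> N \<Longrightarrow> p q \<in> K - N" "\<And>q. q \<in> N \<Longrightarrow> Suc (card (p q)) = card q"
      and De: "\<And>q. q \<in> N \<Longrightarrow> boundary (e q) = e (p q)" "\<And>q. q \<in> K - N \<Longrightarrow> boundary (e q) = 0"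
    by blast
  define E where "E = {\<tau>\<in>K - N. card \<tau> = n + 1}"
  \<comment> \<open>The cycle at \<open>p q\<close> bounds once \<open>q\<close> has entered; a
    basis cycle outside the range of \<open>p\<close> never does, whence the value
    \<open>\<infinity>\<close>.\<close>
  define \<delta> where "\<delta> \<tau> = (if \<tau> \<in> p ` N then ereal (\<phi> (the_inv_into N p \<tau>)) else \<infinity>)" for \<tau>
  have finlev: "finite (lev m t)" for m t using finK by (simp add: lev_def)
  have chains_lev: "chains m (sublevel K \<phi> t) = chain.span (e ` lev (m + 1) t)" for m t
  proof -
    have "{\<sigma>\<in>sublevel K \<phi> t. card \<sigma> = m + 1} = lev (m + 1) t"
      by (auto simp: sublevel_def lev_def)
    then show ?thesis
      using chains_eq_span[OF finK, of "sublevel K \<phi> t" m] by (simp add: sublevel_def levels)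
  qed
  have "cycles n (sublevel K \<phi> t) = chain.span (e ` {\<tau>\<in>E. \<phi> \<tau> \<le> t})" for t
  proof -
    have Et: "{\<tau>\<in>E. \<phi> \<tau> \<le> t} = lev (n + 1) t - N" by (auto simp: E_def lev_def)
    show ?thesis unfolding Et
    proof (intro equalityI subsetI)
      fix x :: "'v set \<Rightarrow>\<^sub>0 'k" assume "x \<in> cycles n (sublevel K \<phi> t)"
      then have x: "x \<in> chain.span (e ` lev (n + 1) t)" "boundary x = 0"
        by (auto simp: cycles_def chains_lev)
      then obtain a where a: "x = (\<Sum>\<tau>\<in>lev (n + 1) t. chain_scale (a \<tau>) (e \<tau>))"
        using chain.span_image_finite_iff[OF finlev] by blast
      \<comment> \<open>Basis cycles drop out here, and the remaining boundaries are distinct basis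
        vectors, so a cycle has no coefficient on \<open>N\<close>.\<close>
      have "0 = (\<Sum>\<tau>\<in>lev (n + 1) t. chain_scale (a \<tau>) (boundary (e \<tau>)))"
        using x(2) by (simp add: a boundary.sum boundary.scale)
      also have "\<dots> = (\<Sum>\<tau>\<in>lev (n + 1) t \<inter> N. chain_scale (a \<tau>) ((e \<circ> p) \<tau>))"
        using finlev De by (intro sum.mono_neutral_cong_right) (auto simp: lev_def)
      finally have z: "(\<Sum>\<tau>\<in>lev (n + 1) t \<inter> N. chain_scale (a \<tau>) ((e \<circ> p) \<tau>)) = 0" by simp
      have "inj_on (e \<circ> p) (lev (n + 1) t \<inter> N)"
        using N(2) e(1) p(1) by (intro comp_inj_on) (auto intro: inj_on_subset)
      moreover have "chain.independent ((e \<circ> p) ` (lev (n + 1) t \<inter> N))"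
        using p(1) by (intro chain.independent_mono[OF e(2)]) auto
      ultimately have "a \<tau> = 0" if "\<tau> \<in> lev (n + 1) t \<inter> N" for \<tau>
        using chain.independent_familyD[of "lev (n + 1) t \<inter> N" "e \<circ> p" a \<tau>] z that finlev by blast
      then have "x = (\<Sum>\<tau>\<in>lev (n + 1) t - N. chain_scale (a \<tau>) (e \<tau>))"
        unfolding a using finlev by (intro sum.mono_neutral_right) auto
      then show "x \<in> chain.span (e ` (lev (n + 1) t - N))"
        using chain.span_image_finite_iff finlev by blast
    next
      fix x assume x: "x \<in> chain.span (e ` (lev (n + 1) t - N))"
      then obtain a where "x = (\<Sum>\<tau>\<in>lev (n + 1) t - N. chain_scale (a \<tau>) (e \<tau>))"
        using chain.span_image_finite_iff[of "lev (n + 1) t - N"] finlev by blast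
      then have "boundary x = (\<Sum>\<tau>\<in>lev (n + 1) t - N. chain_scale (a \<tau>) (boundary (e \<tau>)))"
        by (simp add: boundary.sum boundary.scale)
      also have "\<dots> = 0" using De(2) by (intro sum.neutral) (auto simp: lev_def)
      finally have "boundary x = 0" .
      moreover have "x \<in> chain.span (e ` lev (n + 1) t)"
        using x chain.span_mono[of "e ` (lev (n + 1) t - N)" "e ` lev (n + 1) t"] by blast
      ultimately show "x \<in> cycles n (sublevel K \<phi> t)" by (simp add: cycles_def chains_lev)
    qed
  qed
  moreover have "boundaries n (sublevel K \<phi> t) = chain.span (e ` {\<tau>\<in>E. \<delta> \<tau> \<le> ereal t})" for t
  proof -
    \<comment> \<open>Boundaries in degree \<open>n\<close> come from simplices with
      \<open>n + 2\<close> vertices; these are the partners \<open>q\<close> of the indices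
      collected here.\<close>
    have Et: "{\<tau>\<in>E. \<delta> \<tau> \<le> ereal t} = p ` (N \<inter> lev (n + 2) t)"
    proof (intro equalityI subsetI)
      fix \<tau> assume \<tau>: "\<tau> \<in> {\<tau>\<in>E. \<delta> \<tau> \<le> ereal t}"
      then have "\<tau> \<in> p ` N" by (auto simp: \<delta>_def split: if_splits)
      then obtain q where q: "q \<in> N" "\<tau> = p q" by blast
      then have "\<delta> \<tau> = ereal (\<phi> q)" by (simp add: \<delta>_def the_inv_into_f_f N)
      then have "q \<in> lev (n + 2) t" using \<tau> q N(1) p(2)[OF q(1)] by (auto simp: E_def lev_def)
      then show "\<tau> \<in> p ` (N \<inter> lev (n + 2) t)" using q by blast
    next
      fix \<tau> assume "\<tau> \<in> p ` (N \<inter> lev (n + 2) t)"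
      then obtain q where q: "q \<in> N" "\<tau> = p q" "q \<in> lev (n + 2) t" by blast
      then have "\<delta> \<tau> = ereal (\<phi> q)" by (simp add: \<delta>_def the_inv_into_f_f N)
      then show "\<tau> \<in> {\<tau>\<in>E. \<delta> \<tau> \<le> ereal t}"
        using q p[OF q(1)] by (auto simp: E_def lev_def)
    qed
    have "boundaries n (sublevel K \<phi> t) = chain.span (boundary ` e ` lev (n + 2) t)"
      by (simp add: boundaries_def chains_lev boundary.span_image)
    \<comment> \<open>Indices outside \<open>N\<close> contribute the vector 0 only; with 0 inserted
      on both sides, the two generating sets agree.\<close>
    also have "\<dots> = chain.span (insert 0 (boundary ` e ` lev (n + 2) t))" by simp
    also have "insert 0 (boundary ` e ` lev (n + 2) t) = insert 0 (e ` p ` (N \<inter> lev (n + 2) t))"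
      using De by (force simp: lev_def image_iff)
    finally show ?thesis by (simp add: Et)
  qed
  moreover have "finite E" "inj_on e E"
    using finK e(1) by (auto simp: E_def intro: inj_on_subset)
  moreover have "chain.independent (e ` E)"
    by (rule chain.independent_mono[OF e(2)]) (auto simp: E_def)
  ultimately show ?thesis using that[of E e \<delta>] by blast
qed

section \<open>Interval decomposition of persistent homology\<close>

definition bar_index :: "bar multiset \<Rightarrow> (bar \<times> nat) set" where
  "bar_index B = {(I, i). i < count B I}"

definition bar_sum :: "bar multiset \<Rightarrow> ('k::field, bar \<times> nat \<Rightarrow> 'k) persistence_module" where
  "bar_sum B = finite_direct_sum (bar_index B) (\<lambda>(I, i). interval_module (bar_interval I))"

lemma finite_bar_index: "finite (bar_index B)"
proof -
  have "bar_index B = (SIGMA I:set_mset B. {..<count B I})"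
    by (auto simp: bar_index_def simp flip: count_greater_zero_iff)
  then show ?thesis by simp
qed

lemma carrier_bar_sum:
  "carrier (space (bar_sum B) t) = (\<Pi>\<^sub>E j\<in>bar_index B. if t \<in> bar_interval (fst j) then UNIV else {0})"
  by (auto simp: bar_sum_def finite_direct_sum_def interval_module_def case_prod_unfold intro!: PiE_cong)

lemma add_bar_sum: "x \<oplus>\<^bsub>space (bar_sum B) t\<^esub> y = (\<lambda>j\<in>bar_index B. x j + y j)"
  by (auto simp: bar_sum_def finite_direct_sum_def interval_module_def case_prod_unfold)

lemma smult_bar_sum: "r \<odot>\<^bsub>space (bar_sum B) t\<^esub> x = (\<lambda>j\<in>bar_index B. r * x j)"
  by (auto simp: bar_sum_def finite_direct_sum_def interval_module_def case_prod_unfold)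

lemma trans_bar_sum: "trans (bar_sum B) s t x =
    (\<lambda>j\<in>bar_index B. if s \<in> bar_interval (fst j) \<and> t \<in> bar_interval (fst j) then x j else 0)"
  by (auto simp: bar_sum_def finite_direct_sum_def interval_module_def case_prod_unfold restrict_def)

lemma interval_decomposition_iff:
  "interval_decomposition V B \<longleftrightarrow> (\<forall>I\<in>#B. ereal (fst I) < snd I) \<and> persistence_iso V (bar_sum B)"
  by (simp add: interval_decomposition_def bar_sum_def bar_index_def)

text \<open>Numbering each fibre of \<open>g\<close> identifies the copies of a bar with the
  simplices that produce it.\<close>

lemma bar_index_image_bij:
  assumes "finite E"
  shows "\<exists>h. bij_betw h (bar_index (image_mset g (mset_set E))) E \<and>
    (\<forall>j\<in>bar_index (image_mset g (mset_set E)). g (h j) = fst j)"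
proof -
  let ?J = "bar_index (image_mset g (mset_set E))"
  have count: "count (image_mset g (mset_set E)) I = card {i\<in>E. g i = I}" for I
  proof -
    have "count (image_mset g (mset_set E)) I = (\<Sum>i\<in>{i\<in>E. g i = I}. count (mset_set E) i)"
      using assms unfolding count_image_mset' by (intro sum.cong) auto
    also have "\<dots> = (\<Sum>i\<in>{i\<in>E. g i = I}. 1)"
      using assms by (intro sum.cong) auto
    finally show ?thesis by simp
  qed
  have "\<exists>k. bij_betw k {0..<card {i\<in>E. g i = I}} {i\<in>E. g i = I}" for I
    using assms by (intro ex_bij_betw_nat_finite) simp
  then obtain k where k: "\<And>I. bij_betw (k I) {0..<card {i\<in>E. g i = I}} {i\<in>E. g i = I}" by metis
  define h where "h = (\<lambda>(I, i). k I i)"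
  have hJ: "h j \<in> E \<and> g (h j) = fst j" if "j \<in> ?J" for j
    using that bij_betwE[OF k[of "fst j"]] by (auto simp: bar_index_def count h_def)
  have "inj_on h ?J"
  proof (rule inj_onI)
    fix j j' assume j: "j \<in> ?J" "j' \<in> ?J" "h j = h j'"
    then have "fst j = fst j'" using hJ by metis
    then show "j = j'"
      using j inj_onD[OF bij_betw_imp_inj_on[OF k[of "fst j"]], of "snd j" "snd j'"]
      by (cases j; cases j') (auto simp: bar_index_def count h_def)
  qed
  moreover have "h ` ?J = E"
  proof (intro equalityI subsetI)
    fix i assume i: "i \<in> E"
    then have "i \<in> k (g i) ` {0..<card {i'\<in>E. g i' = g i}}"
      using bij_betw_imp_surj_on[OF k[of "g i"]] by simp
    then obtain n where "n < card {i'\<in>E. g i' = g i}" "i = h (g i, n)" by (auto simp: h_def)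
    then show "i \<in> h ` ?J" by (auto simp: bar_index_def count)
  qed (use hJ in auto)
  ultimately show ?thesis using hJ by (auto simp: bij_betw_def)
qed

theorem interval_decomposition_exists:
  fixes K :: "'v::linorder set set"
  assumes "finite_simplicial_complex K" "filtration_function K \<phi>"
  shows "\<exists>B. interval_decomposition
    (persistent_homology n K \<phi> :: ('k::field_char_0, ('v set \<Rightarrow>\<^sub>0 'k) set) persistence_module) B"
proof -
  define Z :: "real \<Rightarrow> ('v set \<Rightarrow>\<^sub>0 'k) set" where "Z t = cycles n (sublevel K \<phi> t)" for t
  define W :: "real \<Rightarrow> ('v set \<Rightarrow>\<^sub>0 'k) set" where "W t = boundaries n (sublevel K \<phi> t)" for t
  let ?V = "persistent_homology n K \<phi> :: ('k, ('v set \<Rightarrow>\<^sub>0 'k) set) persistence_module"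
  obtain E and e :: "'v set \<Rightarrow> ('v set \<Rightarrow>\<^sub>0 'k)" and \<delta> where
    E: "finite E" "inj_on e E" "chain.independent (e ` E)"
    and Z: "\<And>t. Z t = chain.span (e ` {\<tau>\<in>E. \<phi> \<tau> \<le> t})"
    and W: "\<And>t. W t = chain.span (e ` {\<tau>\<in>E. \<delta> \<tau> \<le> ereal t})"
    unfolding Z_def W_def using persistence_basis_exists[OF assms, of n, where 'k = 'k] by blast
  from chain.family_coordinates_exist[OF E] obtain co where
    co_add: "\<And>x y \<tau>. x \<in> chain.span (e ` E) \<Longrightarrow> y \<in> chain.span (e ` E) \<Longrightarrow>
        co (x + y) \<tau> = co x \<tau> + co y \<tau>"
    and co_scale: "\<And>r x \<tau>. x \<in> chain.span (e ` E) \<Longrightarrow> co (chain_scale r x) \<tau> = r * co x \<tau>"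
    and co_sum: "\<And>a \<tau>. \<tau> \<in> E \<Longrightarrow> co (\<Sum>k\<in>E. chain_scale (a k) (e k)) \<tau> = a \<tau>"
    and co_span: "\<And>x S. x \<in> chain.span (e ` E) \<Longrightarrow> S \<subseteq> E \<Longrightarrow>
        x \<in> chain.span (e ` S) \<longleftrightarrow> (\<forall>\<tau>\<in>E - S. co x \<tau> = 0)"
    by blast
  have ZE: "z \<in> chain.span (e ` E)" if "z \<in> Z t" for z t
    using that chain.span_mono[of "e ` {\<tau>\<in>E. \<phi> \<tau> \<le> t}" "e ` E"] unfolding Z by auto
  have WE: "z \<in> chain.span (e ` E)" if "z \<in> W t" for z t
    using that chain.span_mono[of "e ` {\<tau>\<in>E. \<delta> \<tau> \<le> ereal t}" "e ` E"] unfolding W by auto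
  have Z_iff: "z \<in> Z t \<longleftrightarrow> (\<forall>\<tau>\<in>E. co z \<tau> \<noteq> 0 \<longrightarrow> \<phi> \<tau> \<le> t)" if "z \<in> chain.span (e ` E)" for z t
    unfolding Z using co_span[OF that, of "{\<tau>\<in>E. \<phi> \<tau> \<le> t}"] by auto
  have W_iff: "z \<in> W t \<longleftrightarrow> (\<forall>\<tau>\<in>E. co z \<tau> \<noteq> 0 \<longrightarrow> \<delta> \<tau> \<le> ereal t)" if "z \<in> chain.span (e ` E)" for z t
    unfolding W using co_span[OF that, of "{\<tau>\<in>E. \<delta> \<tau> \<le> ereal t}"] by auto
  have subW: "chain.subspace (W t)" for t by (simp add: W_def subspace_boundaries)
  have subZ: "chain.subspace (Z t)" for t by (simp add: Z_def subspace_cycles)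
  \<comment> \<open>An element with \<open>\<delta> \<tau> \<le> \<phi> \<tau>\<close> bounds as
    soon as it appears and yields no bar.\<close>
  define E' where "E' = {\<tau>\<in>E. ereal (\<phi> \<tau>) < \<delta> \<tau>}"
  define B where "B = image_mset (\<lambda>\<tau>. (\<phi> \<tau>, \<delta> \<tau>)) (mset_set E')"
  have finE': "finite E'" using E(1) by (simp add: E'_def)
  have "\<forall>I\<in>#B. ereal (fst I) < snd I" using finE' by (auto simp: B_def E'_def)
  obtain h where h: "bij_betw h (bar_index B) E'"
    and hI: "\<And>j. j \<in> bar_index B \<Longrightarrow> (\<phi> (h j), \<delta> (h j)) = fst j"
    using bar_index_image_bij[OF finE', of "\<lambda>\<tau>. (\<phi> \<tau>, \<delta> \<tau>)"] unfolding B_def by blast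
  have hE: "h j \<in> E" "h j \<in> E'" if "j \<in> bar_index B" for j
    using bij_betwE[OF h] that by (auto simp: E'_def)
  have bar: "t \<in> bar_interval (fst j) \<longleftrightarrow> \<phi> (h j) \<le> t \<and> ereal t < \<delta> (h j)" if "j \<in> bar_index B" for j t
    by (simp add: bar_interval_def flip: hI[OF that])
  \<comment> \<open>A class is sent to the coordinates of an arbitrary representative on the bars
    alive at \<open>t\<close>.\<close>
  define f where "f t A = (\<lambda>j\<in>bar_index B.
    if t \<in> bar_interval (fst j) then co (SOME z. z \<in> Z t \<and> A = z +o W t) (h j) else 0)" for t A
  have f: "f t (z +o W t) = (\<lambda>j\<in>bar_index B. if t \<in> bar_interval (fst j) then co z (h j) else 0)"
    if z: "z \<in> Z t" for t z
  proof -
    let ?y = "SOME y. y \<in> Z t \<and> z +o W t = y +o W t"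
    have "?y \<in> Z t \<and> z +o W t = ?y +o W t"
      by (rule someI_ex) (use z in blast)
    then have y: "?y \<in> Z t" "z - ?y \<in> W t" using chain.coset_eq_iff[OF subW] by auto
    \<comment> \<open>Changing the representative adds an element of \<open>W t\<close>, which has
      no coordinate on an index that dies after \<open>t\<close>.\<close>
    have "co z (h j) = co ?y (h j)" if j: "j \<in> bar_index B" "t \<in> bar_interval (fst j)" for j
    proof -
      have "co (z - ?y) (h j) = 0"
        using W_iff[OF WE[OF y(2)]] y(2) hE(1)[OF j(1)] j(2) bar[OF j(1)] by force
      moreover have "co (?y + (z - ?y)) (h j) = co ?y (h j) + co (z - ?y) (h j)"
        using co_add[OF ZE[OF y(1)] WE[OF y(2)]] .
      ultimately show ?thesis by simp
    qed
    then show ?thesis by (auto simp: f_def)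
  qed
  have V: "carrier (space ?V t) = (\<lambda>z. z +o W t) ` Z t" for t
    by (simp add: persistent_homology_def carrier_homology Z_def W_def)
  have V_add: "(x +o W t) \<oplus>\<^bsub>space ?V t\<^esub> (y +o W t) = (x + y) +o W t" for x y t
    by (simp add: persistent_homology_def homology_class_add W_def)
  have V_scale: "r \<odot>\<^bsub>space ?V t\<^esub> (x +o W t) = chain_scale r x +o W t" for r x t
    by (simp add: persistent_homology_def homology_class_scale W_def)
  have V_trans: "trans ?V s t (x +o W s) = x +o W t" if "s \<le> t" for s t x
    using homology_class_inclusion[OF sublevel_mono[OF that]]
    by (simp add: persistent_homology_def W_def)
  have "bij_betw (f t) (carrier (space ?V t)) (carrier (space (bar_sum B) t))" for t
  proof (rule bij_betw_imageI)
    show "inj_on (f t) (carrier (space ?V t))"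
    proof (rule inj_onI)
      fix A A' assume "A \<in> carrier (space ?V t)" "A' \<in> carrier (space ?V t)" and eq: "f t A = f t A'"
      then obtain z z' where z: "z \<in> Z t" "A = z +o W t" "z' \<in> Z t" "A' = z' +o W t"
        by (auto simp: V)
      have d: "z - z' \<in> Z t" using z subZ by (simp add: chain.subspace_diff)
      \<comment> \<open>A coordinate with later death would belong to a bar alive at
        \<open>t\<close>, and there the two images agree.\<close>
      have "\<delta> \<tau> \<le> ereal t" if \<tau>: "\<tau> \<in> E" "co (z - z') \<tau> \<noteq> 0" for \<tau>
      proof (rule ccontr)
        assume "\<not> \<delta> \<tau> \<le> ereal t"
        moreover have "\<phi> \<tau> \<le> t" using Z_iff[OF ZE[OF d]] d \<tau> by blast
        ultimately have "\<tau> \<in> E'" "\<phi> \<tau> \<le> t" "ereal t < \<delta> \<tau>"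
          using \<tau>(1) by (auto simp: E'_def intro: le_less_trans[of _ "ereal t"])
        then obtain j where j: "j \<in> bar_index B" "\<tau> = h j" "t \<in> bar_interval (fst j)"
          using bij_betw_imp_surj_on[OF h] bar by blast
        have "co z \<tau> = co z' \<tau>"
          using fun_cong[OF eq, of j] j by (simp add: z(2,4) f[OF z(1)] f[OF z(3)])
        moreover have "co (z' + (z - z')) \<tau> = co z' \<tau> + co (z - z') \<tau>"
          by (rule co_add[OF ZE[OF z(3)] ZE[OF d]])
        ultimately show False using \<tau>(2) by simp
      qed
      then have "z - z' \<in> W t" using W_iff[OF ZE[OF d]] by blast
      then show "A = A'" using z chain.coset_eq_iff[OF subW] by simp
    qed
    show "f t ` carrier (space ?V t) = carrier (space (bar_sum B) t)"
    proof (intro equalityI subsetI)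
      fix y assume "y \<in> f t ` carrier (space ?V t)"
      then show "y \<in> carrier (space (bar_sum B) t)" by (auto simp: V f carrier_bar_sum)
    next
      fix y :: "bar \<times> nat \<Rightarrow> 'k" assume y: "y \<in> carrier (space (bar_sum B) t)"
      \<comment> \<open>The preimage carries the entry of \<open>y\<close> for a bar on the basis
        cycle of that bar; cycles not yet born get 0.\<close>
      define a where "a \<tau> = (if \<tau> \<in> E' \<and> \<phi> \<tau> \<le> t then y (inv_into (bar_index B) h \<tau>) else 0)" for \<tau>
      define z where "z = (\<Sum>\<tau>\<in>E. chain_scale (a \<tau>) (e \<tau>))"
      have "z \<in> chain.span (e ` E)"
        unfolding z_def using chain.span_image_finite_iff[OF E(1)] by blast
      then have z: "z \<in> Z t" using Z_iff by (simp add: z_def co_sum a_def)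
      have "f t (z +o W t) = y"
      proof
        fix j
        show "f t (z +o W t) j = y j"
        proof (cases "j \<in> bar_index B")
          case True
          have "inv_into (bar_index B) h (h j) = j"
            using bij_betw_imp_inj_on[OF h] True by simp
          moreover have "co z (h j) = a (h j)" using hE[OF True] by (simp add: z_def co_sum)
          ultimately have "f t (z +o W t) j = (if t \<in> bar_interval (fst j) then y j else 0)"
            using True hE[OF True] bar[OF True, of t] by (simp add: f[OF z] a_def)
          then show ?thesis using True y by (auto simp: carrier_bar_sum PiE_iff split: if_splits)
        next
          case False
          then show ?thesis using PiE_arb[OF y[unfolded carrier_bar_sum]] f[OF z] by simp
        qed
      qed
      then show "y \<in> f t ` carrier (space ?V t)" using z by (auto simp: V)
    qed
  qed
  moreover have "f t (x \<oplus>\<^bsub>space ?V t\<^esub> y) = f t x \<oplus>\<^bsub>space (bar_sum B) t\<^esub> f t y"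
    if xy: "x \<in> carrier (space ?V t)" "y \<in> carrier (space ?V t)" for t x y
  proof -
    obtain u v where u: "u \<in> Z t" "x = u +o W t" and v: "v \<in> Z t" "y = v +o W t"
      using xy by (auto simp: V)
    then have "u + v \<in> Z t" using subZ by (simp add: chain.subspace_add)
    then show ?thesis
      using u v by (auto simp: V_add f add_bar_sum co_add[OF ZE ZE] hE)
  qed
  moreover have "f t (r \<odot>\<^bsub>space ?V t\<^esub> x) = r \<odot>\<^bsub>space (bar_sum B) t\<^esub> f t x"
    if x: "x \<in> carrier (space ?V t)" for t r x
  proof -
    obtain u where u: "u \<in> Z t" "x = u +o W t" using x by (auto simp: V)
    then have "chain_scale r u \<in> Z t" using subZ by (simp add: chain.subspace_scale)
    then show ?thesis
      using u by (auto simp: V_scale f smult_bar_sum co_scale[OF ZE] hE)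
  qed
  moreover have "f t (trans ?V s t x) = trans (bar_sum B) s t (f s x)"
    if st: "s \<le> t" and x: "x \<in> carrier (space ?V s)" for s t x
  proof -
    obtain u where u: "u \<in> Z s" "x = u +o W s" using x by (auto simp: V)
    have ut: "u \<in> Z t" using u(1) cycles_mono[OF sublevel_mono[OF st]] unfolding Z_def by blast
    \<comment> \<open>A bar alive at \<open>t\<close> but not at the earlier time \<open>s\<close>
      is born after \<open>s\<close>, so a cycle present at \<open>s\<close> has no coordinate on
      it.\<close>
    have "co u (h j) = 0" if "j \<in> bar_index B" "t \<in> bar_interval (fst j)" "s \<notin> bar_interval (fst j)" for j
      using Z_iff[OF ZE[OF u(1)], of s] u(1) hE(1)[OF that(1)] that(2,3) bar[OF that(1)] st
      by (meson ereal_less_eq(3) le_less_trans)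
    then show ?thesis using u ut st by (auto simp: V_trans f trans_bar_sum)
  qed
  ultimately have "persistence_iso ?V (bar_sum B)" unfolding persistence_iso_def by blast
  then show ?thesis using \<open>\<forall>I\<in>#B. ereal (fst I) < snd I\<close> interval_decomposition_iff by blast
qed

section \<open>Stability and uniqueness of barcodes\<close>

definition iso_map ::
  "('k, 'm) persistence_module \<Rightarrow> ('k, 'n) persistence_module \<Rightarrow> (real \<Rightarrow> 'm \<Rightarrow> 'n) \<Rightarrow> bool" where
  "iso_map V W f \<longleftrightarrow>
     (\<forall>t. bij_betw (f t) (carrier (space V t)) (carrier (space W t)) \<and>
       (\<forall>x\<in>carrier (space V t). \<forall>y\<in>carrier (space V t).
          f t (x \<oplus>\<^bsub>space V t\<^esub> y) = f t x \<oplus>\<^bsub>space W t\<^esub> f t y) \<and>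
       (\<forall>r. \<forall>x\<in>carrier (space V t). f t (r \<odot>\<^bsub>space V t\<^esub> x) = r \<odot>\<^bsub>space W t\<^esub> f t x)) \<and>
     (\<forall>s t. s \<le> t \<longrightarrow> (\<forall>x\<in>carrier (space V s). f t (trans V s t x) = trans W s t (f s x)))"

text \<open>A morphism of degree \<open>\<epsilon>\<close>, that is, a morphism from
  \<open>V\<close> to the translate of \<open>W\<close> by \<open>\<epsilon>\<close>.\<close>

definition shift_map ::
  "real \<Rightarrow> ('k, 'm) persistence_module \<Rightarrow> ('k, 'n) persistence_module \<Rightarrow> (real \<Rightarrow> 'm \<Rightarrow> 'n) \<Rightarrow> bool" where
  "shift_map \<epsilon> V W F \<longleftrightarrow>
     (\<forall>t. \<forall>x\<in>carrier (space V t).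
       F t x \<in> carrier (space W (t + \<epsilon>)) \<and>
       (\<forall>y\<in>carrier (space V t).
          F t (x \<oplus>\<^bsub>space V t\<^esub> y) = F t x \<oplus>\<^bsub>space W (t + \<epsilon>)\<^esub> F t y) \<and>
       (\<forall>r. F t (r \<odot>\<^bsub>space V t\<^esub> x) = r \<odot>\<^bsub>space W (t + \<epsilon>)\<^esub> F t x) \<and>
       (\<forall>u\<ge>t. F u (trans V t u x) = trans W (t + \<epsilon>) (u + \<epsilon>) (F t x)))"

text \<open>The record type enforces no module laws; closure is the one that inverting an
  isomorphism relies on.\<close>

definition closed_module :: "('k, 'm) persistence_module \<Rightarrow> bool" where
  "closed_module V \<longleftrightarrow>
     (\<forall>t. \<forall>x\<in>carrier (space V t).
       (\<forall>y\<in>carrier (space V t). x \<oplus>\<^bsub>space V t\<^esub> y \<in> carrier (space V t)) \<and>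
       (\<forall>r. r \<odot>\<^bsub>space V t\<^esub> x \<in> carrier (space V t)) \<and>
       (\<forall>u\<ge>t. trans V t u x \<in> carrier (space V u)))"

text \<open>This is one half of an \<open>\<epsilon>\<close>-interleaving of \<open>V\<close> and \<open>W\<close>.\<close>

definition shift_factors ::
  "real \<Rightarrow> ('k, 'm) persistence_module \<Rightarrow> ('k, 'n) persistence_module \<Rightarrow> bool" where
  "shift_factors \<epsilon> V W \<longleftrightarrow>
     (\<exists>F G. shift_map \<epsilon> V W F \<and> shift_map \<epsilon> W V G \<and>
       (\<forall>t. \<forall>x\<in>carrier (space V t). G (t + \<epsilon>) (F t x) = trans V t (t + 2 * \<epsilon>) x))"

lemma shift_mapD:
  assumes "shift_map \<epsilon> V W F" "x \<in> carrier (space V t)"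
  shows "F t x \<in> carrier (space W (t + \<epsilon>))"
    and "y \<in> carrier (space V t) \<Longrightarrow>
      F t (x \<oplus>\<^bsub>space V t\<^esub> y) = F t x \<oplus>\<^bsub>space W (t + \<epsilon>)\<^esub> F t y"
    and "F t (r \<odot>\<^bsub>space V t\<^esub> x) = r \<odot>\<^bsub>space W (t + \<epsilon>)\<^esub> F t x"
    and "t \<le> u \<Longrightarrow> F u (trans V t u x) = trans W (t + \<epsilon>) (u + \<epsilon>) (F t x)"
  using assms unfolding shift_map_def by blast+

lemma shift_map_comp:
  assumes F: "shift_map \<epsilon> V W F" and G: "shift_map \<delta> W U G"
  shows "shift_map (\<epsilon> + \<delta>) V U (\<lambda>t x. G (t + \<epsilon>) (F t x))"
  unfolding shift_map_def
  using shift_mapD[OF F] shift_mapD[OF G shift_mapD(1)[OF F]]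
  by (simp add: add.assoc)

lemma iso_map_shift_map: "iso_map V W f \<Longrightarrow> shift_map 0 V W f"
  using bij_betwE[of "f t" "carrier (space V t)" "carrier (space W t)" for t]
  by (simp add: iso_map_def shift_map_def)

text \<open>Each law for the inverse is checked by applying \<open>f t\<close>, which is injective
  on the carrier; \<open>closed_module V\<close> places the expected value there.\<close>

lemma iso_map_inverse_shift_map:
  assumes f: "iso_map V W f" and V: "closed_module V"
  shows "shift_map 0 W V (\<lambda>t. inv_into (carrier (space V t)) (f t))"
proof -
  define g where "g t = inv_into (carrier (space V t)) (f t)" for t
  have bij: "bij_betw (f t) (carrier (space V t)) (carrier (space W t))" for t
    using f by (simp add: iso_map_def)
  have g: "g t x \<in> carrier (space V t)" "f t (g t x) = x" if "x \<in> carrier (space W t)" for t x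
    using bij_betw_imp_surj_on[OF bij, of t] that unfolding g_def
    by (auto intro: inv_into_into f_inv_into_f)
  have gI: "g t x = y" if "y \<in> carrier (space V t)" "f t y = x" for t x y
    using bij_betw_imp_inj_on[OF bij, of t] that unfolding g_def by auto
  have "shift_map 0 W V g"
    unfolding shift_map_def
  proof (intro allI ballI conjI impI)
    fix t x assume x: "x \<in> carrier (space W t)"
    note gx = g[OF x]
    show "g t x \<in> carrier (space V (t + 0))" using gx by simp
    show "g t (x \<oplus>\<^bsub>space W t\<^esub> y) = g t x \<oplus>\<^bsub>space V (t + 0)\<^esub> g t y" if y: "y \<in> carrier (space W t)" for y
      using gx g[OF y] f V by (intro gI) (simp_all add: iso_map_def closed_module_def)
    show "g t (r \<odot>\<^bsub>space W t\<^esub> x) = r \<odot>\<^bsub>space V (t + 0)\<^esub> g t x" for r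
      using gx f V by (intro gI) (simp_all add: iso_map_def closed_module_def)
    show "g u (trans W t u x) = trans V (t + 0) (u + 0) (g t x)" if "t \<le> u" for u
      using gx f V that by (intro gI) (simp_all add: iso_map_def closed_module_def)
  qed
  then show ?thesis by (simp add: g_def[abs_def])
qed

text \<open>Conjugation with the isomorphisms, whose inner pair cancels in the composite. It carries
  an interleaving of homology modules over to sums of intervals, where coordinates can be
  computed.\<close>

lemma shift_factors_iso:
  assumes "shift_factors \<epsilon> V W" "persistence_iso V V'" "persistence_iso W W'"
    and "closed_module V" "closed_module W" "0 \<le> \<epsilon>"
  shows "shift_factors \<epsilon> V' W'"
proof -
  obtain F G where F: "shift_map \<epsilon> V W F" and G: "shift_map \<epsilon> W V G"
    and GF: "\<And>t x. x \<in> carrier (space V t) \<Longrightarrow> G (t + \<epsilon>) (F t x) = trans V t (t + 2 * \<epsilon>) x"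
    using assms(1) unfolding shift_factors_def by blast
  obtain f h where f: "iso_map V V' f" and h: "iso_map W W' h"
    using assms(2,3) unfolding persistence_iso_def iso_map_def by blast
  define f' where "f' = (\<lambda>t. inv_into (carrier (space V t)) (f t))"
  define h' where "h' = (\<lambda>t. inv_into (carrier (space W t)) (h t))"
  note f0 = iso_map_shift_map[OF f] and h0 = iso_map_shift_map[OF h]
  have f'0: "shift_map 0 V' V f'"
    unfolding f'_def by (rule iso_map_inverse_shift_map[OF f assms(4)])
  have h'0: "shift_map 0 W' W h'"
    unfolding h'_def by (rule iso_map_inverse_shift_map[OF h assms(5)])
  have F': "shift_map \<epsilon> V' W' (\<lambda>t x. h (t + \<epsilon>) (F t (f' t x)))"
    using shift_map_comp[OF shift_map_comp[OF f'0 F] h0] by simp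
  have G': "shift_map \<epsilon> W' V' (\<lambda>t x. f (t + \<epsilon>) (G t (h' t x)))"
    using shift_map_comp[OF shift_map_comp[OF h'0 G] f0] by simp
  have "f (t + \<epsilon> + \<epsilon>) (G (t + \<epsilon>) (h' (t + \<epsilon>) (h (t + \<epsilon>) (F t (f' t x))))) =
      trans V' t (t + 2 * \<epsilon>) x" if x: "x \<in> carrier (space V' t)" for t x
  proof -
    have fx: "f' t x \<in> carrier (space V t)" using shift_mapD(1)[OF f'0 x] by simp
    have eq: "t + \<epsilon> + \<epsilon> = t + 2 * \<epsilon>" by simp
    have ffx: "f t (f' t x) = x"
      using f x unfolding iso_map_def f'_def by (metis bij_betw_inv_into_right)
    have "h' (t + \<epsilon>) (h (t + \<epsilon>) (F t (f' t x))) = F t (f' t x)"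
      using h shift_mapD(1)[OF F fx] unfolding iso_map_def h'_def by (metis bij_betw_inv_into_left)
    then have "f (t + \<epsilon> + \<epsilon>) (G (t + \<epsilon>) (h' (t + \<epsilon>) (h (t + \<epsilon>) (F t (f' t x))))) =
      f (t + 2 * \<epsilon>) (trans V t (t + 2 * \<epsilon>) (f' t x))"
      unfolding eq using GF[OF fx] by simp
    also have "\<dots> = trans V' t (t + 2 * \<epsilon>) (f t (f' t x))"
      using shift_mapD(4)[OF f0 fx, of "t + 2 * \<epsilon>"] assms(6) by simp
    finally show ?thesis by (simp add: ffx)
  qed
  then show ?thesis unfolding shift_factors_def using F' G' by blast
qed

text \<open>Deaths are compared by sums because they may be infinite: \<open>\<infinity>\<close> is
  then near \<open>\<infinity>\<close> only, and no difference of infinities arises.\<close>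

definition near_bar :: "real \<Rightarrow> bar \<Rightarrow> bar \<Rightarrow> bool" where
  "near_bar \<epsilon> I J \<longleftrightarrow> \<bar>fst I - fst J\<bar> \<le> \<epsilon> \<and> snd I \<le> snd J + ereal \<epsilon> \<and> snd J \<le> snd I + ereal \<epsilon>"

text \<open>There are finitely many endpoints. So \<open>s\<close> can be chosen with no birth
  strictly between \<open>s\<close> and \<open>b - \<epsilon>\<close>, and \<open>T\<close> so late
  that a bar ending after \<open>T\<close> does not end before
  \<open>d - \<epsilon>\<close>.\<close>

lemma finite_bars_gap:
  fixes S :: "bar set"
  assumes "finite S" "ereal (b + 2 * \<epsilon>) < d"
  shows "\<exists>s T. s < b - \<epsilon> \<and> b + \<epsilon> \<le> T \<and> ereal (T + \<epsilon>) < d \<and>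
    (\<forall>J\<in>S. (s < fst J \<longrightarrow> b - \<epsilon> \<le> fst J) \<and> (ereal T < snd J \<longrightarrow> d \<le> snd J + ereal \<epsilon>))"
proof -
  \<comment> \<open>The inserted values keep \<open>A\<close> and \<open>C\<close> nonempty;
    \<open>b + \<epsilon>\<close> also yields \<open>b + \<epsilon> \<le> T\<close>, and it
    qualifies because \<open>b + 2 * \<epsilon> < d\<close>.\<close>
  define A where "A = insert (b - \<epsilon> - 1) {x\<in>fst ` S. x < b - \<epsilon>}"
  define C where "C = insert (b + \<epsilon>) {t. ereal t \<in> snd ` S \<and> ereal (t + \<epsilon>) < d}"
  have "{t. ereal t \<in> snd ` S \<and> ereal (t + \<epsilon>) < d} \<subseteq> real_of_ereal ` snd ` S"
  proof
    fix t assume "t \<in> {t. ereal t \<in> snd ` S \<and> ereal (t + \<epsilon>) < d}"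
    then show "t \<in> real_of_ereal ` snd ` S"
      by (intro image_eqI[of t real_of_ereal "ereal t"]) auto
  qed
  then have "finite {t. ereal t \<in> snd ` S \<and> ereal (t + \<epsilon>) < d}"
    by (rule finite_subset) (use assms(1) in simp)
  then have fin: "finite A" "finite C" using assms(1) by (simp_all add: A_def C_def)
  have "Max A \<in> A" "Max C \<in> C" using Max_in[OF fin(1)] Max_in[OF fin(2)] by (auto simp: A_def C_def)
  then have A: "Max A < b - \<epsilon>" and "ereal (Max C + \<epsilon>) < d"
    using assms(2) by (auto simp: A_def C_def algebra_simps)
  moreover have "b + \<epsilon> \<le> Max C" using fin by (simp add: C_def)
  moreover have "b - \<epsilon> \<le> fst J" if "J \<in> S" "Max A < fst J" for J
  proof (rule ccontr)
    assume "\<not> b - \<epsilon> \<le> fst J"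
    then have "fst J \<in> A" using that by (auto simp: A_def)
    then show False using Max_ge[OF fin(1)] that(2) by force
  qed
  moreover have "d \<le> snd J + ereal \<epsilon>" if J: "J \<in> S" "ereal (Max C) < snd J" for J
  proof (rule ccontr)
    assume "\<not> d \<le> snd J + ereal \<epsilon>"
    then have lt: "snd J + ereal \<epsilon> < d" by simp
    then obtain t where t: "snd J = ereal t" using J(2) by (cases "snd J") auto
    then have "t \<in> C" using lt J(1) by (auto simp: C_def image_iff intro!: bexI[of _ J])
    then show False using Max_ge[OF fin(2)] J(2) t by force
  qed
  ultimately show ?thesis by blast
qed

text \<open>A dimension count. Were there fewer near bars than copies of \<open>(b, d)\<close>, some
  nonzero combination of the copies would map to an element with no coordinate on a near bar. Such
  an element comes from time \<open>s\<close>, which contradicts the birth of the copies at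
  \<open>b\<close>.\<close>

theorem box_lemma:
  fixes B B' :: "bar multiset" and X Y :: "('k::field, bar \<times> nat \<Rightarrow> 'k) persistence_module"
  defines "X \<equiv> bar_sum B" and "Y \<equiv> bar_sum B'"
  assumes XY: "shift_factors \<epsilon> X Y"
    and "0 \<le> \<epsilon>" and bd: "ereal (b + 2 * \<epsilon>) < d"
  shows "count B (b, d) \<le> card {j\<in>bar_index B'. near_bar \<epsilon> (b, d) (fst j)}"
proof (rule ccontr)
  define N where "N = {j\<in>bar_index B'. near_bar \<epsilon> (b, d) (fst j)}"
  assume "\<not> count B (b, d) \<le> card {j\<in>bar_index B'. near_bar \<epsilon> (b, d) (fst j)}"
  then have card: "card N < count B (b, d)" by (simp add: N_def)
  have finN: "finite N" using finite_bar_index by (simp add: N_def)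
  obtain F G where F: "shift_map \<epsilon> X Y F" and G: "shift_map \<epsilon> Y X G"
    and GF: "\<And>t x. x \<in> carrier (space X t) \<Longrightarrow> G (t + \<epsilon>) (F t x) = trans X t (t + 2 * \<epsilon>) x"
    using XY unfolding shift_factors_def by blast
  obtain s T where s: "s < b - \<epsilon>" and T: "b + \<epsilon> \<le> T" "ereal (T + \<epsilon>) < d"
    and gap: "\<And>J. J \<in># B' \<Longrightarrow> s < fst J \<Longrightarrow> b - \<epsilon> \<le> fst J"
      "\<And>J. J \<in># B' \<Longrightarrow> ereal T < snd J \<Longrightarrow> d \<le> snd J + ereal \<epsilon>"
    using finite_bars_gap[OF finite_set_mset bd, of B'] by blast
  have I: "t \<in> bar_interval (b, d)" if "b \<le> t" "t \<le> T + \<epsilon>" for t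
    using that T(2) le_less_trans[of "ereal t" "ereal (T + \<epsilon>)" d] by (simp add: bar_interval_def)
  define x :: "(nat \<Rightarrow> 'k) \<Rightarrow> bar \<times> nat \<Rightarrow> 'k" where
    "x a = (\<lambda>j\<in>bar_index B. if fst j = (b, d) then a (snd j) else 0)" for a
  have x: "x a \<in> carrier (space X b)" for a
    using I[of b] T(1) assms(4) by (auto simp: x_def X_def carrier_bar_sum)
  have x_add: "x (\<lambda>i. a i + a' i) = x a \<oplus>\<^bsub>space X b\<^esub> x a'" for a a'
    by (auto simp: x_def X_def add_bar_sum)
  have x_scale: "x (\<lambda>i. r * a i) = r \<odot>\<^bsub>space X b\<^esub> x a" for r a
    by (auto simp: x_def X_def smult_bar_sum)
  \<comment> \<open>At time \<open>T\<close> the bars that end before \<open>d - \<epsilon>\<close>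
    are already gone.\<close>
  define z where "z a = trans Y (b + \<epsilon>) T (F b (x a))" for a
  have "z (\<lambda>i. a i + a' i) j = z a j + z a' j" if "j \<in> N" for a a' j
    using that shift_mapD(2)[OF F x x]
    by (auto simp: z_def x_add Y_def trans_bar_sum add_bar_sum N_def)
  moreover have "z (\<lambda>i. r * a i) j = r * z a j" if "j \<in> N" for r a j
    using that shift_mapD(3)[OF F x]
    by (auto simp: z_def x_scale Y_def trans_bar_sum smult_bar_sum N_def)
  ultimately obtain a where a: "\<exists>i<count B (b, d). a i \<noteq> 0" "\<And>j. j \<in> N \<Longrightarrow> z a j = 0"
    using functionals_common_zero[OF finN card, of z] by blast
  have Fx: "F b (x a) \<in> carrier (space Y (b + \<epsilon>))" by (rule shift_mapD(1)[OF F x])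
  have z: "z a \<in> carrier (space Y T)"
    using Fx by (auto simp: z_def Y_def trans_bar_sum carrier_bar_sum)
  \<comment> \<open>\<open>x a\<close> is zero at time \<open>d\<close>, so its image is zero at
    \<open>d + \<epsilon>\<close>; for infinite \<open>d\<close> the bound is trivial.\<close>
  have dies: "snd (fst j) \<le> d + ereal \<epsilon>" if j: "j \<in> bar_index B'" "z a j \<noteq> 0" for j
  proof (cases d)
    case (real d')
    have dT: "T \<le> d' + \<epsilon>" "b \<le> d'" "T + \<epsilon> \<le> d'" using T(2) bd assms(4) by (simp_all add: real)
    have "trans X b d' (x a) = (\<lambda>j\<in>bar_index B. 0)"
      by (auto simp: X_def trans_bar_sum x_def bar_interval_def real)
    \<comment> \<open>Shift maps are only known to preserve sums and multiples, so zero passes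
      through \<open>F\<close> as a multiple by 0.\<close>
    also have "\<dots> = 0 \<odot>\<^bsub>space X d'\<^esub> (\<lambda>j\<in>bar_index B. 0)"
      by (auto simp: X_def smult_bar_sum)
    finally have "F d' (trans X b d' (x a)) = 0 \<odot>\<^bsub>space Y (d' + \<epsilon>)\<^esub> F d' (\<lambda>j\<in>bar_index B. 0)"
      using shift_mapD(3)[OF F, of "\<lambda>j\<in>bar_index B. 0" d' 0] by (simp add: X_def carrier_bar_sum)
    then have "trans Y (b + \<epsilon>) (d' + \<epsilon>) (F b (x a)) j = 0"
      using shift_mapD(4)[OF F x dT(2)] j(1) by (simp add: Y_def smult_bar_sum)
    moreover have "b + \<epsilon> \<in> bar_interval (fst j)" "T \<in> bar_interval (fst j)" "z a j = F b (x a) j"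
      using j by (auto simp: z_def Y_def trans_bar_sum split: if_splits)
    ultimately have "d' + \<epsilon> \<notin> bar_interval (fst j)"
      using j by (auto simp: Y_def trans_bar_sum)
    then have "snd (fst j) \<le> ereal (d' + \<epsilon>)"
      using \<open>T \<in> bar_interval (fst j)\<close> dT by (auto simp: bar_interval_def)
    then show ?thesis by (simp add: real)
  qed (use bd in auto)
  \<comment> \<open>The bar of a nonzero coordinate is not near \<open>(b, d)\<close>, yet its death
    is within \<open>\<epsilon>\<close> of \<open>d\<close> and its birth is at most
    \<open>b + \<epsilon>\<close>. Hence it is born before \<open>b - \<epsilon>\<close>, and by the
    choice of \<open>s\<close> no later than \<open>s\<close>.\<close>
  have born: "s \<in> bar_interval (fst j) \<and> T \<in> bar_interval (fst j)" if j: "j \<in> bar_index B'" "z a j \<noteq> 0" for j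
  proof -
    have j': "b + \<epsilon> \<in> bar_interval (fst j)" "T \<in> bar_interval (fst j)"
      using j by (auto simp: z_def Y_def trans_bar_sum split: if_splits)
    have "fst j \<in># B'" using j(1) by (auto simp: bar_index_def simp flip: count_greater_zero_iff)
    note gap = gap[OF this]
    have "\<not> near_bar \<epsilon> (b, d) (fst j)" using a(2)[of j] j unfolding N_def by blast
    then have "fst (fst j) \<le> s"
      using gap j' dies[OF j] by (fastforce simp: near_bar_def bar_interval_def)
    moreover have "ereal s < snd (fst j)"
      using j'(2) s T(1) assms(4) le_less_trans[of "ereal s" "ereal T" "snd (fst j)"]
      by (simp add: bar_interval_def)
    ultimately show ?thesis using j' by (simp add: bar_interval_def)
  qed
  \<comment> \<open>On a bar alive at both \<open>s\<close> and \<open>T\<close> the transition map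
    is the identity, so copying the coordinates of \<open>z a\<close> gives a preimage at time
    \<open>s\<close>.\<close>
  define w where "w = (\<lambda>j\<in>bar_index B'. if s \<in> bar_interval (fst j) then z a j else 0)"
  have w: "w \<in> carrier (space Y s)" by (auto simp: w_def Y_def carrier_bar_sum)
  have "z a = trans Y s T w"
  proof
    fix j show "z a j = trans Y s T w j"
    proof (cases "j \<in> bar_index B'")
      case True
      then show ?thesis using born[of j] by (auto simp: w_def Y_def trans_bar_sum)
    next
      case False
      then show ?thesis using PiE_arb[OF z[unfolded Y_def carrier_bar_sum]] by (simp add: Y_def trans_bar_sum)
    qed
  qed
  then have "G T (z a) = trans X (s + \<epsilon>) (T + \<epsilon>) (G s w)"
    using shift_mapD(4)[OF G w, of T] s T(1) assms(4) by simp
  moreover have "G T (z a) = trans X (b + 2 * \<epsilon>) (T + \<epsilon>) (trans X b (b + 2 * \<epsilon>) (x a))"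
    using shift_mapD(4)[OF G Fx T(1)] GF[OF x] by (simp add: z_def add.assoc)
  ultimately have eq: "trans X (b + 2 * \<epsilon>) (T + \<epsilon>) (trans X b (b + 2 * \<epsilon>) (x a)) =
    trans X (s + \<epsilon>) (T + \<epsilon>) (G s w)" by simp
  \<comment> \<open>On the right of \<open>eq\<close> the copies are not yet born at
    \<open>s + \<epsilon> < b\<close>; on the left \<open>b\<close>,
    \<open>b + 2 * \<epsilon>\<close> and \<open>T + \<epsilon>\<close> lie in the bar, so the
    coordinate is \<open>a i\<close>.\<close>
  have "s + \<epsilon> \<notin> bar_interval (b, d)" using s by (simp add: bar_interval_def)
  then have "a i = 0" if "i < count B (b, d)" for i
    using fun_cong[OF eq, of "((b, d), i)"] that I[of b] I[of "b + 2 * \<epsilon>"] I[of "T + \<epsilon>"] T(1) assms(4)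
    by (simp add: X_def trans_bar_sum x_def bar_index_def)
  then show False using a(1) by blast
qed

section \<open>Interleaving of sublevel persistent homology\<close>

lemma persistent_homology_simps:
  fixes K :: "'v::linorder set set" and \<phi> :: "'v set \<Rightarrow> real" and n :: nat
  defines "V \<equiv> persistent_homology n K \<phi> :: ('k::field, ('v set \<Rightarrow>\<^sub>0 'k) set) persistence_module"
  shows "carrier (space V t) = (\<lambda>z. z +o boundaries n (sublevel K \<phi> t)) ` cycles n (sublevel K \<phi> t)"
    and "(x +o boundaries n (sublevel K \<phi> t)) \<oplus>\<^bsub>space V t\<^esub> (y +o boundaries n (sublevel K \<phi> t)) =
      (x + y) +o boundaries n (sublevel K \<phi> t)"
    and "r \<odot>\<^bsub>space V t\<^esub> (x +o boundaries n (sublevel K \<phi> t)) =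
      chain_scale r x +o boundaries n (sublevel K \<phi> t)"
    and "s \<le> t \<Longrightarrow> trans V s t (x +o boundaries n (sublevel K \<phi> s)) = x +o boundaries n (sublevel K \<phi> t)"
  by (simp_all add: V_def persistent_homology_def carrier_homology homology_class_add
      homology_class_scale homology_class_inclusion sublevel_mono)

lemma closed_persistent_homology:
  "closed_module (persistent_homology n K \<phi> :: ('k::field, ('v::linorder set \<Rightarrow>\<^sub>0 'k) set) persistence_module)"
proof -
  have "x + y \<in> cycles n S" "chain_scale r x \<in> cycles n S"
    if "x \<in> cycles n S" "y \<in> cycles n S" for x y :: "'v set \<Rightarrow>\<^sub>0 'k" and r S
    using that by (auto intro: chain.subspace_add[OF subspace_cycles] chain.subspace_scale[OF subspace_cycles])
  moreover have "x \<in> cycles n (sublevel K \<phi> u)" if "x \<in> cycles n (sublevel K \<phi> t)" "t \<le> u"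
    for x :: "'v set \<Rightarrow>\<^sub>0 'k" and t u
    using that cycles_mono[OF sublevel_mono] by blast
  ultimately show ?thesis
    unfolding closed_module_def by (auto simp: persistent_homology_simps)
qed

text \<open>The bound embeds the sublevel complex of \<open>\<phi>\<close> at \<open>t\<close> in
  that of \<open>\<psi>\<close> at \<open>t + \<epsilon>\<close>, and these inclusions commute with
  those along the filtrations.\<close>

lemma shift_map_persistent_homology:
  fixes K :: "'v::linorder set set"
  assumes close: "\<And>\<sigma>. \<sigma> \<in> K \<Longrightarrow> \<psi> \<sigma> \<le> \<phi> \<sigma> + \<epsilon>"
  shows "shift_map \<epsilon>
    (persistent_homology n K \<phi> :: ('k::field, ('v set \<Rightarrow>\<^sub>0 'k) set) persistence_module)
    (persistent_homology n K \<psi>) (\<lambda>t A. A + boundaries n (sublevel K \<psi> (t + \<epsilon>)))"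
proof -
  have sub: "sublevel K \<phi> t \<subseteq> sublevel K \<psi> (t + \<epsilon>)" for t
    using close by (fastforce simp: sublevel_def)
  have incl: "(x +o boundaries n (sublevel K \<phi> t)) + boundaries n (sublevel K \<psi> (t + \<epsilon>)) =
      x +o boundaries n (sublevel K \<psi> (t + \<epsilon>))" for x :: "'v set \<Rightarrow>\<^sub>0 'k" and t
    by (rule homology_class_inclusion[OF sub])
  have "x \<in> cycles n (sublevel K \<psi> (t + \<epsilon>))" if "x \<in> cycles n (sublevel K \<phi> t)"
    for x :: "'v set \<Rightarrow>\<^sub>0 'k" and t
    using that cycles_mono[OF sub] by blast
  then show ?thesis
    unfolding shift_map_def by (auto simp: persistent_homology_simps incl)
qed

lemma shift_factors_persistent_homology:
  fixes K :: "'v::linorder set set"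
  assumes "\<And>\<sigma>. \<sigma> \<in> K \<Longrightarrow> \<bar>\<phi> \<sigma> - \<psi> \<sigma>\<bar> \<le> \<epsilon>" "0 \<le> \<epsilon>"
  shows "shift_factors \<epsilon>
    (persistent_homology n K \<phi> :: ('k::field, ('v set \<Rightarrow>\<^sub>0 'k) set) persistence_module)
    (persistent_homology n K \<psi>)"
proof -
  have close: "\<psi> \<sigma> \<le> \<phi> \<sigma> + \<epsilon>" "\<phi> \<sigma> \<le> \<psi> \<sigma> + \<epsilon>" if "\<sigma> \<in> K" for \<sigma>
    using assms(1)[OF that] by linarith+
  have sub: "sublevel K \<phi> t \<subseteq> sublevel K \<psi> (t + \<epsilon>)"
    "sublevel K \<psi> (t + \<epsilon>) \<subseteq> sublevel K \<phi> (t + \<epsilon> + \<epsilon>)" for t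
    using close by (fastforce simp: sublevel_def)+
  let ?V = "persistent_homology n K \<phi> :: ('k, ('v set \<Rightarrow>\<^sub>0 'k) set) persistence_module"
  have "A + boundaries n (sublevel K \<psi> (t + \<epsilon>)) + boundaries n (sublevel K \<phi> (t + \<epsilon> + \<epsilon>)) =
      trans ?V t (t + 2 * \<epsilon>) A" if A: "A \<in> carrier (space ?V t)" for t A
  proof -
    have eq: "t + \<epsilon> + \<epsilon> = t + 2 * \<epsilon>" by simp
    obtain z where z: "A = z +o boundaries n (sublevel K \<phi> t)"
      using A by (auto simp: persistent_homology_simps)
    have "A + boundaries n (sublevel K \<psi> (t + \<epsilon>)) + boundaries n (sublevel K \<phi> (t + \<epsilon> + \<epsilon>)) =
        z +o boundaries n (sublevel K \<phi> (t + \<epsilon> + \<epsilon>))"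
      by (simp only: z homology_class_inclusion[OF sub(1)] homology_class_inclusion[OF sub(2)])
    also have "\<dots> = trans ?V t (t + 2 * \<epsilon>) A"
      unfolding eq using assms(2) by (simp add: z persistent_homology_simps)
    finally show ?thesis .
  qed
  then show ?thesis
    unfolding shift_factors_def
    by (intro exI[of _ "\<lambda>t A. A + boundaries n (sublevel K \<psi> (t + \<epsilon>))"]
        exI[of _ "\<lambda>t A. A + boundaries n (sublevel K \<phi> (t + \<epsilon>))"] conjI allI ballI
        shift_map_persistent_homology close)
qed

text \<open>At \<open>\<epsilon> = 0\<close> near bars are equal bars, so the box lemma, used in
  both directions, compares multiplicities. The record type imposes no laws on \<open>trans\<close>;
  \<open>shift_factors 0 V V\<close> supplies what relates the two decompositions.\<close>

theorem barcode_unique: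
  fixes V :: "('k::field, 'm) persistence_module"
  assumes B: "interval_decomposition V B" and B': "interval_decomposition V B'"
    and V: "closed_module V" "shift_factors 0 V V"
  shows "B = B'"
proof -
  have le: "count B I \<le> count B' I"
    if "interval_decomposition V B" "interval_decomposition V B'" for B B' I
  proof (cases "I \<in># B")
    case True
    obtain b d where I: "I = (b, d)" by (cases I)
    have "{j\<in>bar_index B'. near_bar 0 I (fst j)} \<subseteq> Pair I ` {..<count B' I}"
    proof
      fix j assume "j \<in> {j\<in>bar_index B'. near_bar 0 I (fst j)}"
      then have j: "j \<in> bar_index B'" "near_bar 0 I (fst j)" by auto
      then have "fst j = I"
        by (intro prod_eqI) (auto simp: near_bar_def zero_ereal_def[symmetric])
      then show "j \<in> Pair I ` {..<count B' I}"
        using j(1) by (cases j) (auto simp: bar_index_def)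
    qed
    then have "card {j\<in>bar_index B'. near_bar 0 I (fst j)} \<le> card (Pair I ` {..<count B' I})"
      by (intro card_mono) simp_all
    also have "\<dots> \<le> card {..<count B' I}" by (rule card_image_le) simp
    finally have "card {j\<in>bar_index B'. near_bar 0 I (fst j)} \<le> count B' I" by simp
    moreover have "ereal b < d" using that(1) True I by (auto simp: interval_decomposition_iff)
    moreover have "shift_factors 0 (bar_sum B :: ('k, _) persistence_module) (bar_sum B')"
      using that by (intro shift_factors_iso[OF V(2) _ _ V(1,1)]) (simp_all add: interval_decomposition_iff)
    ultimately have "count B (b, d) \<le> count B' I"
      using box_lemma[of 0 B B' b d, where 'k = 'k] by (simp add: I)
    then show ?thesis by (simp add: I)
  next
    case False
    then show ?thesis by (simp add: not_in_iff)
  qed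
  show ?thesis using le[OF B B'] le[OF B' B] by (intro multiset_eqI antisym)
qed

text \<open>\<open>barcode\<close> is a definite description, so existence and uniqueness together
  make it denote a decomposition.\<close>

lemma interval_decomposition_barcode:
  fixes K :: "'v::linorder set set" and \<phi> :: "'v set \<Rightarrow> real" and n :: nat
  assumes "finite_simplicial_complex K" "filtration_function K \<phi>"
  defines "V \<equiv> persistent_homology n K \<phi> :: ('k::field_char_0, ('v set \<Rightarrow>\<^sub>0 'k) set) persistence_module"
  shows "interval_decomposition V (barcode V)"
proof -
  have "shift_factors 0 V V"
    unfolding V_def by (rule shift_factors_persistent_homology) simp_all
  moreover have "closed_module V" by (simp add: V_def closed_persistent_homology)
  moreover obtain B where B: "interval_decomposition V B"
    using interval_decomposition_exists[OF assms(1,2), of n, where 'k = 'k] unfolding V_def by blast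
  ultimately have "\<exists>!B. interval_decomposition V B" using barcode_unique by blast
  then show ?thesis unfolding barcode_def by (rule theI')
qed

text \<open>In the box lemma for the two barcode decompositions, a positive multiplicity of
  \<open>(b, d)\<close> forces the set of near bars to be nonempty.\<close>

theorem barcode_stability:
  fixes K :: "'v::linorder set set"
  assumes K: "finite_simplicial_complex K"
    and \<phi>: "filtration_function K \<phi>" and \<psi>: "filtration_function K \<psi>"
    and close: "\<And>\<sigma>. \<sigma> \<in> K \<Longrightarrow> \<bar>\<phi> \<sigma> - \<psi> \<sigma>\<bar> \<le> \<epsilon>" and "0 \<le> \<epsilon>"
    and I: "(b, d) \<in># barcode (persistent_homology n K \<phi>
           :: ('k::field_char_0, ('v set \<Rightarrow>\<^sub>0 'k) set) persistence_module)"
    and long: "ereal (b + 2 * \<epsilon>) < d"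
  shows "\<exists>J. J \<in># barcode (persistent_homology n K \<psi>
           :: ('k, ('v set \<Rightarrow>\<^sub>0 'k) set) persistence_module) \<and> near_bar \<epsilon> (b, d) J"
proof -
  let ?V = "persistent_homology n K \<phi> :: ('k, ('v set \<Rightarrow>\<^sub>0 'k) set) persistence_module"
  let ?W = "persistent_homology n K \<psi> :: ('k, ('v set \<Rightarrow>\<^sub>0 'k) set) persistence_module"
  have "shift_factors \<epsilon> (bar_sum (barcode ?V) :: ('k, _) persistence_module) (bar_sum (barcode ?W) :: ('k, _) persistence_module)"
  proof (rule shift_factors_iso)
    show "shift_factors \<epsilon> ?V ?W"
      using close \<open>0 \<le> \<epsilon>\<close> by (rule shift_factors_persistent_homology)
    show "persistence_iso ?V (bar_sum (barcode ?V))" "persistence_iso ?W (bar_sum (barcode ?W))"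
      using interval_decomposition_barcode[OF K \<phi>, of n, where 'k = 'k]
        interval_decomposition_barcode[OF K \<psi>, of n, where 'k = 'k]
      by (simp_all add: interval_decomposition_iff)
  qed (use \<open>0 \<le> \<epsilon>\<close> in \<open>simp_all add: closed_persistent_homology\<close>)
  from box_lemma[OF this \<open>0 \<le> \<epsilon>\<close> long]
  have "card {j\<in>bar_index (barcode ?W). near_bar \<epsilon> (b, d) (fst j)} \<noteq> 0"
    using I by (simp flip: count_greater_zero_iff)
  then obtain j where "j \<in> bar_index (barcode ?W)" "near_bar \<epsilon> (b, d) (fst j)"
    by (metis (mono_tags, lifting) card.empty empty_Collect_eq)
  then show ?thesis
    by (intro exI[of _ "fst j"]) (auto simp: bar_index_def simp flip: count_greater_zero_iff)
qed

theorem corollary11: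
  fixes K :: "'v::linorder set set"
    and absv :: "'k::field_char_0 \<Rightarrow> real"
    and scale :: "'k \<Rightarrow> 'a::ab_group_add \<Rightarrow> 'a"
    and Basis :: "'a set"
    and nrm :: "'a \<Rightarrow> real"
    and \<phi> :: "'a \<Rightarrow> 'v set \<Rightarrow> real"
    and L b :: real
    and d :: ereal
    and c c' :: 'a
    and n :: nat
  assumes "finite_simplicial_complex K"
    and "fin_dim_normed_space absv scale Basis nrm"
    and "\<And>a. filtration_function K (\<phi> a)"
    and "L \<ge> 0"
    and "\<And>a a'. (SUP \<sigma>\<in>K. ereal \<bar>\<phi> a \<sigma> - \<phi> a' \<sigma>\<bar>) \<le> ereal (L * nrm (a - a'))"
    and "(b, d) \<in># barcode (persistent_homology n K (\<phi> c)
           :: ('k, ('v set \<Rightarrow>\<^sub>0 'k) set) persistence_module)"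
    and "ereal (L * nrm (c - c')) < (d - ereal b) / 2"
  shows "\<exists>b' d'. (b', d') \<in># barcode (persistent_homology n K (\<phi> c')
           :: ('k, ('v set \<Rightarrow>\<^sub>0 'k) set) persistence_module) \<and>
         \<bar>b - b'\<bar> \<le> L * nrm (c - c') \<and>
         (if d = \<infinity> then d' = \<infinity> else \<bar>d - d'\<bar> \<le> ereal (L * nrm (c - c')))"
proof -
  define \<epsilon> where "\<epsilon> = L * nrm (c - c')"
  have "0 \<le> nrm (c - c')" using assms(2) by (rule fin_dim_normed_space.nrm_nonneg)
  then have \<epsilon>: "0 \<le> \<epsilon>" using assms(4) by (simp add: \<epsilon>_def)
  have close: "\<bar>\<phi> c \<sigma> - \<phi> c' \<sigma>\<bar> \<le> \<epsilon>" if "\<sigma> \<in> K" for \<sigma>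
    using order_trans[OF SUP_upper[OF that] assms(5)[of c c']] by (simp add: \<epsilon>_def)
  have long: "ereal (b + 2 * \<epsilon>) < d"
    using assms(7) by (cases d) (auto simp: \<epsilon>_def)
  obtain b' d' where J: "(b', d') \<in># barcode (persistent_homology n K (\<phi> c')
           :: ('k, ('v set \<Rightarrow>\<^sub>0 'k) set) persistence_module)" "near_bar \<epsilon> (b, d) (b', d')"
    using barcode_stability[OF assms(1) assms(3) assms(3) close \<epsilon> assms(6) long] by auto
  \<comment> \<open>For infinite \<open>d\<close> the sums in \<open>near_bar\<close> leave only
    \<open>d' = \<infinity>\<close>; for finite \<open>d\<close> they force \<open>d'\<close> to be
    finite.\<close>
  moreover have "if d = \<infinity> then d' = \<infinity> else \<bar>d - d'\<bar> \<le> ereal \<epsilon>"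
    using J(2) long by (cases d; cases d') (auto simp: near_bar_def)
  ultimately show ?thesis by (intro exI[of _ b'] exI[of _ d']) (simp add: near_bar_def flip: \<epsilon>_def)
qed

end
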